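(* Let $d\ge1$, let $\pi$ be a Borel probability measure on $\mathbb X:=\mathbb R^d$, let $U$ be a Markov operator with stationary probability $\pi$, let $\alpha\in(1/2,1)$, and let $(X_n)_{n\ge0}$ be a Markov chain with transition kernel $P:=\alpha\pi+(1-\alpha)U$ (Knudsen gas), whose initial distribution admits a density with respect to $\pi$ belonging to $L^p(\pi)$ for some $p>1$. Assume moreover that $\kappa\equiv2$ and that $\pi(\xi>0)=1$. Then $\nu$ is finite. If, moreover, $\pi(\xi^\tau)<\infty$ for some $\tau\in(1,p/(p-1))$, then the limit $$C_\nu:=\lim_{\gamma\to0^+}\frac{\gamma}{\gamma+\nu}G(\nu+\gamma)$$ is well defined, $C_\nu\in(0,+\infty)$, and $$\lim_{t\to\infty}\frac1t\int_0^te^{-\nu s}\,\mathbb E(N_s)\,ds=C_\nu.$$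
   Context: $\xi:\mathbb X\to[0,+\infty)$ is a measurable function (lifetime) and $\kappa:\mathbb X\to\{2,3,\dots\}$ (number of new cells), here constant equal to $2$. In $P=\alpha\pi+(1-\alpha)U$, $\pi$ stands for the kernel $(x,dy)\mapsto\pi(dy)$. $S_n:=\sum_{k=0}^n\xi(X_k)$; $g_n(\gamma):=\mathbb E[(\prod_{j=0}^{n-1}\kappa(X_j))(\kappa(X_n)-1)e^{-\gamma S_n}]$ (so $g_n(\gamma)=2^n\mathbb E[e^{-\gamma S_n}]$ here); $G(\gamma):=\sum_{n\ge0}g_n(\gamma)$; $\nu:=\inf\{\gamma>0:G(\gamma)<\infty\}$. Branching process. Cells are labelled by finite sequences $v=(k_1,\dots,k_n)$ of positive integers (the empty sequence labels the initial cell, born at time $0$). To each label $v$ is attached an $\mathbb X$-valued random variable $X_v$ such that, along every infinite line of descent $(v_n)_{n\ge0}$ ($v_0=\emptyset$, $v_{n+1}$ obtained from $v_n$ by appending one positive integer), $(X_{v_n})_{n\ge0}$ has the law of $(X_n)_{n\ge0}$. A cell $v$ lives for a time $\xi(X_v)$ and then splits into $\kappa(X_v)$ cells, labelled by appending $1,\dots,\kappa(X_v)$ to $v$. $N_t$ is the number of cells alive at time $t$ (a cell being alive from its birth time, included, to its death time, excluded). *)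

theory Defs
  imports "HOL-Probability.Probability"
begin

(* The kernel alpha pi + (1 - alpha) U, where pi is read as the constant kernel x |-> pi. *)
definition knudsen_kernel ::
  "real \<Rightarrow> 'a::topological_space measure \<Rightarrow> ('a \<Rightarrow> 'a measure) \<Rightarrow> 'a \<Rightarrow> 'a measure" where
  "knudsen_kernel \<alpha> \<pi> U x =
     measure_of UNIV (sets borel)
       (\<lambda>A. ennreal \<alpha> * emeasure \<pi> A + ennreal (1 - \<alpha>) * emeasure (U x) A)"

(* measure_of silently yields the zero measure when its last argument is not a measure;
   this excludes that case. *)
lemma emeasure_knudsen_kernel:
  assumes "sets \<pi> = sets borel" "sets (U x) = sets borel" "A \<in> sets borel"
  shows "emeasure (knudsen_kernel \<alpha> \<pi> U x) A =
           ennreal \<alpha> * emeasure \<pi> A + ennreal (1 - \<alpha>) * emeasure (U x) A"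
proof -
  let ?m = "\<lambda>A. ennreal \<alpha> * emeasure \<pi> A + ennreal (1 - \<alpha>) * emeasure (U x) A"
  have "emeasure (measure_of UNIV (sets borel) ?m) A = ?m A"
  proof (rule emeasure_measure_of_sigma)
    show "sigma_algebra UNIV (sets (borel :: 'a measure))"
      using sets.sigma_algebra_axioms[of "borel :: 'a measure"] by simp
    show "positive (sets borel) ?m"
      by (simp add: positive_def)
    show "countably_additive (sets borel) ?m"
    proof (rule countably_additiveI)
      fix F :: "nat \<Rightarrow> 'a set"
      assume F: "range F \<subseteq> sets borel" "disjoint_family F" "(\<Union>i. F i) \<in> sets borel"
      have "(\<Sum>i. emeasure \<pi> (F i)) = emeasure \<pi> (\<Union>i. F i)"
        using F assms by (intro suminf_emeasure) auto
      moreover have "(\<Sum>i. emeasure (U x) (F i)) = emeasure (U x) (\<Union>i. F i)"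
        using F assms by (intro suminf_emeasure) auto
      ultimately show "(\<Sum>i. ?m (F i)) = ?m (\<Union>i. F i)"
        by (simp flip: suminf_add)
    qed
  qed (use assms in simp)
  then show ?thesis
    by (simp add: knudsen_kernel_def)
qed

(* The sigma-algebra generated by X 0, ..., X n. *)
definition past_algebra ::
  "'w measure \<Rightarrow> (nat \<Rightarrow> 'w \<Rightarrow> 'a::topological_space) \<Rightarrow> nat \<Rightarrow> 'w measure" where
  "past_algebra M X n =
     vimage_algebra (space M) (\<lambda>\<omega>. \<lambda>k\<in>{..n}. X k \<omega>) (\<Pi>\<^sub>M k\<in>{..n}. borel)"

definition markov_chain ::
  "'w measure \<Rightarrow> ('a::topological_space \<Rightarrow> 'a measure) \<Rightarrow> (nat \<Rightarrow> 'w \<Rightarrow> 'a) \<Rightarrow> bool" where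
  "markov_chain M P X \<longleftrightarrow>
     prob_space M \<and>
     (\<forall>n. X n \<in> borel_measurable M) \<and>
     (\<forall>n. \<forall>A\<in>sets borel. AE \<omega> in M.
        real_cond_exp M (past_algebra M X n) (\<lambda>\<omega>. indicator A (X (Suc n) \<omega>)) \<omega>
          = measure (P (X n \<omega>)) A)"

definition partial_sum :: "(nat \<Rightarrow> 'w \<Rightarrow> 'a) \<Rightarrow> ('a \<Rightarrow> real) \<Rightarrow> nat \<Rightarrow> 'w \<Rightarrow> real" where
  "partial_sum X \<xi> n \<omega> = (\<Sum>k\<le>n. \<xi> (X k \<omega>))"

definition g_term ::
  "'w measure \<Rightarrow> (nat \<Rightarrow> 'w \<Rightarrow> 'a) \<Rightarrow> ('a \<Rightarrow> real) \<Rightarrow> ('a \<Rightarrow> nat) \<Rightarrow> nat \<Rightarrow> real \<Rightarrow> ennreal" where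
  "g_term M X \<xi> \<kappa> n \<gamma> =
     (\<integral>\<^sup>+\<omega>. ennreal ((\<Prod>j<n. real (\<kappa> (X j \<omega>))) * (real (\<kappa> (X n \<omega>)) - 1)
                     * exp (- \<gamma> * partial_sum X \<xi> n \<omega>)) \<partial>M)"

definition G_series ::
  "'w measure \<Rightarrow> (nat \<Rightarrow> 'w \<Rightarrow> 'a) \<Rightarrow> ('a \<Rightarrow> real) \<Rightarrow> ('a \<Rightarrow> nat) \<Rightarrow> real \<Rightarrow> ennreal" where
  "G_series M X \<xi> \<kappa> \<gamma> = (\<Sum>n. g_term M X \<xi> \<kappa> n \<gamma>)"

(* Extended-real valued: the infimum is infinite when G is infinite everywhere. *)
definition growth_rate ::
  "'w measure \<Rightarrow> (nat \<Rightarrow> 'w \<Rightarrow> 'a) \<Rightarrow> ('a \<Rightarrow> real) \<Rightarrow> ('a \<Rightarrow> nat) \<Rightarrow> ereal" where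
  "growth_rate M X \<xi> \<kappa> = Inf (ereal ` {\<gamma>. \<gamma> > 0 \<and> G_series M X \<xi> \<kappa> \<gamma> < \<infinity>})"

definition line_of_descent :: "(nat \<Rightarrow> nat list) \<Rightarrow> bool" where
  "line_of_descent v \<longleftrightarrow> v 0 = [] \<and> (\<forall>n. \<exists>k\<ge>1. v (Suc n) = v n @ [k])"

(* Y indexes the cells by lists of positive integers; its values at other lists are irrelevant.
   Only the laws along single lines of descent are prescribed, not the joint law of the family. *)
definition branching_family ::
  "'v measure \<Rightarrow> (nat list \<Rightarrow> 'v \<Rightarrow> 'a::topological_space) \<Rightarrow>
   'w measure \<Rightarrow> (nat \<Rightarrow> 'w \<Rightarrow> 'a) \<Rightarrow> bool" where
  "branching_family M' Y M X \<longleftrightarrow>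
     prob_space M' \<and>
     (\<forall>v. (\<forall>k\<in>set v. k \<ge> 1) \<longrightarrow> Y v \<in> borel_measurable M') \<and>
     (\<forall>v. line_of_descent v \<longrightarrow>
        distr M' (\<Pi>\<^sub>M n\<in>UNIV. borel) (\<lambda>\<omega> n. Y (v n) \<omega>)
          = distr M (\<Pi>\<^sub>M n\<in>UNIV. borel) (\<lambda>\<omega> n. X n \<omega>))"

definition cell_exists ::
  "(nat list \<Rightarrow> 'v \<Rightarrow> 'a) \<Rightarrow> ('a \<Rightarrow> nat) \<Rightarrow> 'v \<Rightarrow> nat list \<Rightarrow> bool" where
  "cell_exists Y \<kappa> \<omega> v \<longleftrightarrow> (\<forall>i<length v. 1 \<le> v ! i \<and> v ! i \<le> \<kappa> (Y (take i v) \<omega>))"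

definition birth_time ::
  "(nat list \<Rightarrow> 'v \<Rightarrow> 'a) \<Rightarrow> ('a \<Rightarrow> real) \<Rightarrow> 'v \<Rightarrow> nat list \<Rightarrow> real" where
  "birth_time Y \<xi> \<omega> v = (\<Sum>i<length v. \<xi> (Y (take i v) \<omega>))"

definition alive_cells ::
  "(nat list \<Rightarrow> 'v \<Rightarrow> 'a) \<Rightarrow> ('a \<Rightarrow> real) \<Rightarrow> ('a \<Rightarrow> nat) \<Rightarrow> real \<Rightarrow> 'v \<Rightarrow> nat list set" where
  "alive_cells Y \<xi> \<kappa> t \<omega> =
     {v. cell_exists Y \<kappa> \<omega> v \<and> birth_time Y \<xi> \<omega> v \<le> t \<and>
         t < birth_time Y \<xi> \<omega> v + \<xi> (Y v \<omega>)}"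

(* Counting measure instead of card, which would be 0 on infinite sets. *)
definition num_alive ::
  "(nat list \<Rightarrow> 'v \<Rightarrow> 'a) \<Rightarrow> ('a \<Rightarrow> real) \<Rightarrow> ('a \<Rightarrow> nat) \<Rightarrow> real \<Rightarrow> 'v \<Rightarrow> ennreal" where
  "num_alive Y \<xi> \<kappa> t \<omega> = emeasure (count_space UNIV) (alive_cells Y \<xi> \<kappa> t \<omega>)"

definition mean_alive ::
  "'v measure \<Rightarrow> (nat list \<Rightarrow> 'v \<Rightarrow> 'a) \<Rightarrow> ('a \<Rightarrow> real) \<Rightarrow> ('a \<Rightarrow> nat) \<Rightarrow> real \<Rightarrow> ennreal" where
  "mean_alive M' Y \<xi> \<kappa> t = (\<integral>\<^sup>+\<omega>. num_alive Y \<xi> \<kappa> t \<omega> \<partial>M')"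

end

theory Submission imports Defs begin

text \<open>Splitting each move of the chain into a redraw from \<open>\<pi>\<close> (weight \<open>2 \<alpha>\<close>, counting the two
  daughters) and a U-move (weight \<open>2 (1 - \<alpha>) < 1\<close>) gives a renewal structure. Let R be the
  expected discounted number of cells met before the first redraw, a convergent series, let
  \<open>r(\<gamma>) = 2 \<alpha> \<pi>(R)\<close>, and let \<open>\<mu>\<close> be the initial law. Then \<open>G = \<mu>(R) / (1 - r)\<close> where \<open>r < 1\<close>,
  and \<open>G = \<infinity>\<close> elsewhere. As a function of \<open>\<gamma>\<close>, r is continuous, decreasing and convex,
  \<open>r(0) = 2 \<alpha> / (2 \<alpha> - 1) > 1\<close>, and \<open>r \<rightarrow> 0\<close> at infinity since \<open>\<xi> > 0\<close> almost everywhere. So r crosses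
  1 exactly once, at \<open>\<nu> > 0\<close>; by convexity the difference quotient there has a limit, finite because
  \<open>\<nu>\<close> is an interior point and nonzero because r does fall below 1. Hence G has a simple pole at \<open>\<nu>\<close>.
  Finally the Laplace transform of the mean number of cells is \<open>(1 + G(\<gamma>)) / \<gamma>\<close>, and Karamata's
  Tauberian theorem turns the pole into the limit of the Cesaro means.\<close>

section \<open>Karamata's Tauberian theorem\<close>

text \<open>By Stone-Weierstrass a continuous test function is within e/3 of a polynomial on [0,1].
  The integrals of the polynomial converge by the moment hypothesis, and since all the laws live on
  [0,1] each of the two replacements costs at most e/3.\<close>

lemma weak_conv_of_moments:
  assumes N: "\<And>n. real_distribution (N n)" and M: "real_distribution M"
    and N01: "\<And>n. AE x in N n. x \<in> {0..1}" and M01: "AE x in M. x \<in> {0..1}"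
    and mom: "\<And>k. (\<lambda>n. \<integral>x. x ^ k \<partial>N n) \<longlonglongrightarrow> (\<integral>x. x ^ k \<partial>M)"
  shows "weak_conv_m N M"
proof (rule integral_bdd_continuous_conv_imp_weak_conv[OF N M])
  fix f :: "real \<Rightarrow> real"
  assume f: "\<And>x. isCont f x" and fb: "\<And>x. \<bar>f x\<bar> \<le> 1"
  have fm: "f \<in> borel_measurable borel"
    by (intro borel_measurable_continuous_onI continuous_at_imp_continuous_on ballI f)
  have int_pow: "integrable Q (\<lambda>x. x ^ k)"
    if "real_distribution Q" "AE x in Q. x \<in> {0..1}" for Q :: "real measure" and k :: nat
  proof -
    interpret real_distribution Q by fact
    show ?thesis
      by (rule integrable_const_bound[of _ 1]) (use that(2) in \<open>auto simp: power_le_one\<close>)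
  qed
  show "(\<lambda>n. \<integral>x. f x \<partial>N n) \<longlonglongrightarrow> (\<integral>x. f x \<partial>M)"
  proof (rule tendstoI)
    fix e :: real assume e: "0 < e"
    obtain g where "real_polynomial_function g" and g: "\<And>x. x \<in> {0..1} \<Longrightarrow> \<bar>f x - g x\<bar> < e / 3"
      using Stone_Weierstrass_real_polynomial_function[of "{0..1}" f "e/3"] f e
      by (auto simp: continuous_at_imp_continuous_on)
    then obtain a d where gsum: "g = (\<lambda>x. \<Sum>i\<le>d. a i * x ^ i)"
      using real_polynomial_function_iff_sum by blast
    have int_g: "integrable Q g"
      and close: "\<bar>(\<integral>x. f x \<partial>Q) - (\<integral>x. g x \<partial>Q)\<bar> \<le> e / 3"
      if Q: "real_distribution Q" "AE x in Q. x \<in> {0..1}" for Q :: "real measure"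
    proof -
      interpret real_distribution Q by fact
      show ig: "integrable Q g"
        unfolding gsum by (intro Bochner_Integration.integrable_sum integrable_mult_right int_pow Q)
      have if': "integrable Q f"
        by (rule integrable_const_bound[of _ 1]) (use fb fm in \<open>auto\<close>)
      have "\<bar>(\<integral>x. f x \<partial>Q) - (\<integral>x. g x \<partial>Q)\<bar> = \<bar>\<integral>x. f x - g x \<partial>Q\<bar>"
        using ig if' by simp
      also have "\<dots> \<le> (\<integral>x. \<bar>f x - g x\<bar> \<partial>Q)"
        by (rule integral_abs_bound)
      also have "\<dots> \<le> (\<integral>x. e / 3 \<partial>Q)"
        using Q(2) by (intro integral_mono_AE) (use ig if' g in \<open>auto intro: less_imp_le\<close>)
      finally show "\<bar>(\<integral>x. f x \<partial>Q) - (\<integral>x. g x \<partial>Q)\<bar> \<le> e / 3"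
        using prob_space by simp
    qed
    have int_g_eq: "(\<integral>x. g x \<partial>Q) = (\<Sum>i\<le>d. a i * (\<integral>x. x ^ i \<partial>Q))"
      if Q: "real_distribution Q" "AE x in Q. x \<in> {0..1}" for Q :: "real measure"
      unfolding gsum using int_pow[OF Q] by (subst Bochner_Integration.integral_sum) auto
    have "(\<lambda>n. \<integral>x. g x \<partial>N n) \<longlonglongrightarrow> (\<integral>x. g x \<partial>M)"
      unfolding int_g_eq[OF N N01] int_g_eq[OF M M01] by (intro tendsto_intros mom)
    then have "\<forall>\<^sub>F n in sequentially. dist (\<integral>x. g x \<partial>N n) (\<integral>x. g x \<partial>M) < e / 3"
      using e by (intro tendstoD) auto
    then show "\<forall>\<^sub>F n in sequentially. dist (\<integral>x. f x \<partial>N n) (\<integral>x. f x \<partial>M) < e"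
    proof eventually_elim
      case (elim n)
      then show ?case
        using close[OF N[of n] N01[of n]] close[OF M M01] unfolding dist_real_def by linarith
    qed
  qed
qed

text \<open>The limit law of the Tauberian argument. The last integral is that of the test function
  \<open>g\<close> in \<open>karamata_tauberian\<close>, namely ln 1 - ln (exp (-1)) = 1.\<close>

lemma uniform_unit_interval:
  defines "M \<equiv> density lborel (indicator {0..1::real})"
  shows "real_distribution M" and "AE x in M. x \<in> {0..1}"
    and "(\<integral>x. x ^ k \<partial>M) = 1 / real (Suc k)"
    and "(\<integral>x. (if exp (-1) \<le> x then 1 / x else 0) \<partial>M) = 1"
proof -
  show "real_distribution M"
    unfolding real_distribution_def real_distribution_axioms_def M_def
    by (auto intro!: prob_spaceI simp: emeasure_density)
  show "AE x in M. x \<in> {0..1}"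
    unfolding M_def by (subst AE_density) (auto simp: indicator_def split: if_splits)
  have eq: "(\<integral>x. f x \<partial>M) = (\<integral>x. f x * indicator {0..1} x \<partial>lborel)" if "f \<in> borel_measurable borel" for f :: "real \<Rightarrow> real"
    unfolding M_def using that
    by (subst integral_density[where g="indicator {0..1}", unfolded ennreal_indicator]) (auto simp: mult.commute)
  have "((\<lambda>x. x ^ Suc k / real (Suc k)) has_real_derivative x ^ k) (at x)" for x :: real
    by (auto intro!: derivative_eq_intros simp del: power_Suc) 
  then have "has_bochner_integral lborel (\<lambda>x. x ^ k * indicator {0..1} x)
          (1 ^ Suc k / real (Suc k) - 0 ^ Suc k / real (Suc k))"
    by (intro has_bochner_integral_FTC_Icc_nonneg)
       (auto intro: has_field_derivative_at_within)
  then show "(\<integral>x. x ^ k \<partial>M) = 1 / real (Suc k)"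
    by (subst eq) (auto dest: has_bochner_integral_integral_eq)
  have "has_bochner_integral lborel (\<lambda>x. 1 / x * indicator {exp (-1)..1} x) (ln 1 - ln (exp (-1 :: real)))"
    by (intro has_bochner_integral_FTC_Icc_nonneg)
       (auto intro!: derivative_eq_intros dest: less_le_trans[OF exp_gt_zero])
  moreover have "(\<lambda>x. (if exp (-1) \<le> x then 1 / x else 0) * indicator {0..1::real} x)
      = (\<lambda>x. 1 / x * indicator {exp (-1)..1} x)"
    by (auto simp: fun_eq_iff indicator_def dest: less_le_trans[OF exp_gt_zero])
  ultimately show "(\<integral>x. (if exp (-1) \<le> x then 1 / x else 0) \<partial>M) = 1"
    by (subst eq) (auto dest: has_bochner_integral_integral_eq)
qed

text \<open>Karamata's method: normalise exp(-\<delta> s) u(s) ds to a probability and push it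
  forward by s |-> exp(-\<delta> s). Its k-th moment is L((k+1)\<delta>) / L(\<delta>), which tends
  to 1/(k+1), the moment of the uniform law on [0,1]. Weak convergence then admits a discontinuous
  test function that restores the sharp cutoff at s = 1/\<delta>.\<close>

theorem karamata_tauberian:
  fixes u :: "real \<Rightarrow> ennreal" and L :: "real \<Rightarrow> real"
  assumes u[measurable]: "u \<in> borel_measurable borel"
    and Lpos: "\<And>\<delta>. \<delta> > 0 \<Longrightarrow> L \<delta> > 0"
    and L: "\<And>\<delta>. \<delta> > 0 \<Longrightarrow> (\<integral>\<^sup>+s\<in>{0..}. ennreal (exp (- \<delta> * s)) * u s \<partial>lborel) = ennreal (L \<delta>)"
    and lim: "((\<lambda>\<delta>. \<delta> * L \<delta>) \<longlongrightarrow> C) (at_right 0)" and C: "C > 0"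
  shows "((\<lambda>t. ennreal (1 / t) * (\<integral>\<^sup>+s\<in>{0..t}. u s \<partial>lborel)) \<longlongrightarrow> ennreal C) at_top"
proof (rule tendsto_at_topI_sequentially)
  fix X :: "nat \<Rightarrow> real" assume X: "filterlim X at_top sequentially"
  \<comment> \<open>The Laplace parameter matching the cutoff \<open>X n\<close>; the value 1 only
    keeps \<open>\<delta> n\<close> positive at the finitely many n with
    \<open>X n \<le> 0\<close>.\<close>
  define \<delta> where "\<delta> n = (if X n > 0 then 1 / X n else 1)" for n
  have \<delta>: "\<delta> n > 0" for n by (simp add: \<delta>_def)
  have Xpos: "\<forall>\<^sub>F n in sequentially. X n > 0"
    using X by (auto simp: filterlim_at_top_dense)
  have "filterlim (\<lambda>n. inverse (X n)) (at_right 0) sequentially"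
    by (rule filterlim_compose[OF filterlim_inverse_at_right_top X])
  then have \<delta>0: "filterlim \<delta> (at_right 0) sequentially"
    by (rule filterlim_mono_eventually)
       (use Xpos in \<open>auto simp: \<delta>_def field_simps elim!: eventually_mono\<close>)
  have limk: "(\<lambda>n. c * \<delta> n * L (c * \<delta> n)) \<longlonglongrightarrow> C" if "c > 0" for c
  proof (rule filterlim_compose[OF lim])
    have "filterlim (\<lambda>x. c * x) (at_right 0) (at_right (0::real))"
      using \<open>c > 0\<close>
      by (auto simp: filterlim_at eventually_at_right_less intro!: tendsto_eq_intros eventually_at_rightI[of 0 1])
    then show "filterlim (\<lambda>n. c * \<delta> n) (at_right 0) sequentially"
      by (rule filterlim_compose[OF _ \<delta>0])
  qed
  define w where "w n s = ennreal (exp (- \<delta> n * s)) * u s * indicator {0..} s / ennreal (L (\<delta> n))" for n s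
  have w[measurable]: "w n \<in> borel_measurable borel" for n
    unfolding w_def by measurable
  \<comment> \<open>The k extra factors move the Laplace parameter from \<delta> n to (k+1) \<delta>
    n; the case k = 0 says that \<open>w n\<close> has total mass 1.\<close>
  have wk: "(\<integral>\<^sup>+s. w n s * ennreal (exp (- \<delta> n * s) ^ k) \<partial>lborel)
      = ennreal (L (real (Suc k) * \<delta> n) / L (\<delta> n))" for n k
  proof -
    have e: "ennreal (exp (- \<delta> n * s)) * ennreal (exp (- \<delta> n * s) ^ k)
        = ennreal (exp (- (real (Suc k) * \<delta> n) * s))" for s
      by (simp add: ennreal_mult[symmetric] exp_of_nat_mult[symmetric] mult_exp_exp algebra_simps)
    have "(\<integral>\<^sup>+s. w n s * ennreal (exp (- \<delta> n * s) ^ k) \<partial>lborel)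
        = (\<integral>\<^sup>+s. (ennreal (exp (- (real (Suc k) * \<delta> n) * s)) * u s * indicator {0..} s) / ennreal (L (\<delta> n)) \<partial>lborel)"
      by (intro nn_integral_cong)
         (simp only: w_def divide_ennreal_def e[symmetric], simp only: mult_ac)
    also have "\<dots> = ennreal (L (real (Suc k) * \<delta> n)) / ennreal (L (\<delta> n))"
      by (subst nn_integral_divide) (use L[of "real (Suc k) * \<delta> n"] \<delta>[of n] in \<open>auto\<close>)
    also have "\<dots> = ennreal (L (real (Suc k) * \<delta> n) / L (\<delta> n))"
      using Lpos[of "real (Suc k) * \<delta> n"] Lpos[of "\<delta> n"] \<delta>[of n] by (intro divide_ennreal) auto
    finally show ?thesis .
  qed
  define N where "N n = distr (density lborel (w n)) borel (\<lambda>s. exp (- \<delta> n * s))" for n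
  have N: "real_distribution (N n)" for n
  proof -
    have "prob_space (density lborel (w n))"
      using wk[of n 0] Lpos[OF \<delta>[of n]] by (intro prob_spaceI) (simp add: emeasure_density)
    then show ?thesis
      unfolding N_def real_distribution_def real_distribution_axioms_def
      by (auto intro!: prob_space.prob_space_distr)
  qed
  have N01: "AE x in N n. x \<in> {0..1}" for n
    using less_imp_le[OF \<delta>[of n]] unfolding N_def
    by (subst AE_distr_iff) (auto simp: AE_density w_def indicator_def)
  have intN: "(\<integral>x. f x \<partial>N n) = enn2real (\<integral>\<^sup>+s. w n s * ennreal (f (exp (- \<delta> n * s))) \<partial>lborel)"
    if f[measurable]: "f \<in> borel_measurable borel" and nn: "\<And>x. x > 0 \<Longrightarrow> f x \<ge> 0" for f n
    unfolding N_def using nn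
    by (simp add: integral_distr integral_eq_nn_integral nn_integral_density)
  define M where "M = density lborel (indicator {0..1::real})"
  have "weak_conv_m N M"
  proof (rule weak_conv_of_moments[OF N _ N01])
    show "real_distribution M" "AE x in M. x \<in> {0..1}"
      using uniform_unit_interval unfolding M_def by auto
    fix k
    \<comment> \<open>The moment is written with products of the form c \<delta> L(c \<delta>), each
      tending to C, so that C cancels and 1/(k+1) remains.\<close>
    have "(\<integral>x. x ^ k \<partial>N n) = (real (Suc k) * \<delta> n * L (real (Suc k) * \<delta> n)) / (1 * \<delta> n * L (1 * \<delta> n)) / real (Suc k)" for n
      using Lpos[of "\<delta> n"] Lpos[of "real (Suc k) * \<delta> n"] \<delta>[of n] wk[of n k]
      by (subst intN) (auto simp: field_simps simp del: of_nat_Suc)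
    moreover have "(\<lambda>n. (real (Suc k) * \<delta> n * L (real (Suc k) * \<delta> n)) / (1 * \<delta> n * L (1 * \<delta> n)) / real (Suc k))
        \<longlonglongrightarrow> C / C / real (Suc k)"
      using C by (intro tendsto_intros limk) auto
    ultimately show "(\<lambda>n. \<integral>x. x ^ k \<partial>N n) \<longlonglongrightarrow> (\<integral>x. x ^ k \<partial>M)"
      using C uniform_unit_interval(3)[of k] by (simp add: M_def)
  qed
  \<comment> \<open>The factor 1/x cancels the weight exp(-\<delta> s), and x \<ge> exp(-1) means s
    \<le> 1/\<delta>. The only discontinuity, at exp(-1), is a null set of the uniform law.\<close>
  define g :: "real \<Rightarrow> real" where "g x = (if exp (-1) \<le> x then 1 / x else 0)" for x
  have g[measurable]: "g \<in> borel_measurable borel"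
    unfolding g_def by measurable
  have g_bound: "0 \<le> g x \<and> g x \<le> exp 1" for x
  proof (cases "exp (-1) \<le> x")
    case True
    then have "x > 0" by (rule less_le_trans[OF exp_gt_zero])
    moreover have "1 / x \<le> 1 / exp (-1)"
      using True \<open>x > 0\<close> by (intro divide_left_mono) auto
    ultimately show ?thesis
      using True by (auto simp: g_def exp_minus inverse_eq_divide)
  qed (simp add: g_def)
  have "(\<lambda>n. \<integral>x. g x \<partial>N n) \<longlonglongrightarrow> (\<integral>x. g x \<partial>M)"
  proof (rule weak_conv_imp_bdd_ae_continuous_conv[OF N _ \<open>weak_conv_m N M\<close>])
    show "real_distribution M"
      using uniform_unit_interval unfolding M_def by auto
    have "isCont g x" if "x \<noteq> exp (-1)" for x
    proof (cases "x < exp (-1)")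
      case True
      then have "\<forall>\<^sub>F y in nhds x. g y = 0"
        unfolding g_def eventually_nhds by (intro exI[of _ "{..<exp (-1)}"]) auto
      then show ?thesis
        by (subst isCont_cong[where g="\<lambda>_. 0"]) auto
    next
      case False
      with that have "x > exp (-1)" by simp
      then have "\<forall>\<^sub>F y in nhds x. g y = 1 / y"
        unfolding g_def eventually_nhds by (intro exI[of _ "{exp (-1)<..}"]) auto
      then show ?thesis
        using less_trans[OF exp_gt_zero \<open>x > exp (-1)\<close>]
        by (subst isCont_cong[where g="\<lambda>y. 1 / y"]) (auto intro!: continuous_intros)
    qed
    then have "{x. \<not> isCont g x} \<subseteq> {exp (-1)}" by auto
    moreover have "emeasure M {exp (-1)} = 0"
    proof -
      have "AE x in lborel. x \<noteq> exp (-1 :: real)"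
        by (rule AE_lborel_singleton)
      then show ?thesis
        unfolding M_def by (subst emeasure_density) (auto intro!: nn_integral_zero' elim!: eventually_mono simp: indicator_def)
    qed
    ultimately show "emeasure M {x. \<not> isCont g x} = 0"
      by (metis (no_types, lifting) M_def emeasure_mono le_zero_eq sets_density sets_lborel borel_singleton sets.empty_sets)
    show "norm (g x) \<le> exp 1" for x
      using g_bound[of x] by simp
  qed fact
  \<comment> \<open>Multiplying by \<delta> n L(\<delta> n) undoes the normalisation and supplies
    the factor 1/t.\<close>
  then have "(\<lambda>n. 1 * \<delta> n * L (1 * \<delta> n) * (\<integral>x. g x \<partial>N n)) \<longlonglongrightarrow> C * 1"
    using uniform_unit_interval(4) by (intro tendsto_mult limk) (auto simp: M_def g_def)
  then have "(\<lambda>n. ennreal (\<delta> n * L (\<delta> n) * (\<integral>x. g x \<partial>N n))) \<longlonglongrightarrow> ennreal C"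
    by (intro tendsto_ennrealI) simp
  moreover have "\<forall>\<^sub>F n in sequentially. ennreal (\<delta> n * L (\<delta> n) * (\<integral>x. g x \<partial>N n))
      = ennreal (1 / X n) * (\<integral>\<^sup>+s\<in>{0..X n}. u s \<partial>lborel)"
    using Xpos
  proof eventually_elim
    case (elim n)
    then have \<delta>n: "\<delta> n = 1 / X n" by (simp add: \<delta>_def)
    have "w n s * ennreal (g (exp (- \<delta> n * s))) = u s * indicator {0..X n} s / ennreal (L (\<delta> n))" for s
    proof -
      have "g (exp (- \<delta> n * s)) = exp (\<delta> n * s) * indicator {..X n} s"
        using elim by (auto simp: g_def \<delta>n field_simps exp_minus indicator_def)
      then show ?thesis
        by (auto simp: w_def divide_ennreal_def indicator_def exp_minus ennreal_mult[symmetric] mult_ac)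
    qed
    then have eq: "(\<integral>\<^sup>+s. w n s * ennreal (g (exp (- \<delta> n * s))) \<partial>lborel)
       = (\<integral>\<^sup>+s\<in>{0..X n}. u s \<partial>lborel) / ennreal (L (\<delta> n))" (is "_ = ?I / _")
      by (simp add: nn_integral_divide)
    \<comment> \<open>Finiteness must come first: \<open>intN\<close> goes through
      \<open>enn2real\<close>, which would turn an infinite integral into 0.\<close>
    have "(\<integral>\<^sup>+s. w n s * ennreal (g (exp (- \<delta> n * s))) \<partial>lborel)
        \<le> (\<integral>\<^sup>+s. w n s * ennreal (exp 1) \<partial>lborel)"
      using g_bound by (intro nn_integral_mono mult_left_mono ennreal_leI) auto
    also have "\<dots> < \<infinity>"
      using wk[of n 0] by (simp add: nn_integral_multc ennreal_mult_less_top)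
    finally have "?I / ennreal (L (\<delta> n)) < \<infinity>"
      unfolding eq .
    then have "?I < \<infinity>"
      using Lpos[OF \<delta>[of n]] by (auto simp: ennreal_divide_eq_top_iff less_top[symmetric])
    then obtain i where i: "?I = ennreal i" "i \<ge> 0"
      by (cases ?I) auto
    have "(\<integral>x. g x \<partial>N n) = i / L (\<delta> n)"
      unfolding intN[OF g conjunct1[OF g_bound]] eq i(1)
      using Lpos[OF \<delta>[of n]] i(2) by (simp add: divide_ennreal)
    then show ?case
      using Lpos[OF \<delta>[of n]] i elim by (simp add: ennreal_mult[symmetric] \<delta>n)
  qed
  ultimately show "(\<lambda>n. ennreal (1 / X n) * (\<integral>\<^sup>+s\<in>{0..X n}. u s \<partial>lborel)) \<longlonglongrightarrow> ennreal C"
    by (rule Lim_transform_eventually)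
qed

section \<open>Convex decreasing functions of the discount rate\<close>

text \<open>The chord of the product exceeds the product of the chords by t (1 - t) (f x - f y) (g x
  - g y), which is nonnegative because both functions decrease.\<close>

lemma convex_on_mul_antimono:
  fixes f g :: "real \<Rightarrow> real"
  assumes f: "convex_on S f" "antimono_on S f" "\<And>x. x \<in> S \<Longrightarrow> f x \<ge> 0"
    and g: "convex_on S g" "antimono_on S g" "\<And>x. x \<in> S \<Longrightarrow> g x \<ge> 0"
  shows "convex_on S (\<lambda>x. f x * g x)"
proof (intro convex_on_linorderI)
  show "convex S"
    using f(1) by (rule convex_on_imp_convex)
  fix t x y :: real
  assume t: "0 < t" "t < 1" and xy: "x \<in> S" "y \<in> S" "x < y"
  have inS: "(1 - t) * x + t * y \<in> S"
    using t xy \<open>convex S\<close> by (simp add: convex_alt)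
  have le: "f y \<le> f x" "g y \<le> g x"
    using xy f(2) g(2) by (auto simp: monotone_on_def)
  have "0 \<le> t * (1 - t) * ((f x - f y) * (g x - g y))"
    using t le by auto
  moreover have "f ((1 - t) * x + t * y) * g ((1 - t) * x + t * y)
      \<le> ((1 - t) * f x + t * f y) * ((1 - t) * g x + t * g y)"
    using convex_onD[OF f(1), of t x y] convex_onD[OF g(1), of t x y] t xy f(3) g(3) inS
    by (intro mult_mono) auto
  ultimately show "f ((1 - t) *\<^sub>R x + t *\<^sub>R y) * g ((1 - t) *\<^sub>R x + t *\<^sub>R y)
      \<le> (1 - t) * (f x * g x) + t * (f y * g y)"
    by (simp add: algebra_simps)
qed

text \<open>The intermediate value theorem gives a crossing point, and convexity forbids a plateau
  at level y, since r gets below y later. The quotient \<open>q\<close> decreases in d by convexity,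
  so its limit at 0 is its supremum: finite because the chord on the left of a bounds it, positive
  because \<open>q 1\<close> is.\<close>

lemma convex_antimono_crossing:
  fixes r :: "real \<Rightarrow> real"
  assumes conv: "convex_on {0..} r" and anti: "antimono_on {0..} r"
    and cont: "continuous_on {0..} r" and r0: "r 0 > y" and b: "b \<ge> 0" "r b < y"
  obtains a l where "a > 0" "l > 0" "\<And>x. 0 \<le> x \<Longrightarrow> x \<le> a \<Longrightarrow> r x \<ge> y" "\<And>x. x > a \<Longrightarrow> r x < y"
    and "((\<lambda>d. (y - r (a + d)) / d) \<longlongrightarrow> l) (at_right 0)"
proof -
  have "\<exists>a\<ge>0. a \<le> b \<and> r a = y"
    using assms by (intro IVT2') (auto intro: continuous_on_subset)
  then obtain a where a: "a \<ge> 0" "a \<le> b" "r a = y" by auto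
  with r0 have "a > 0" by (cases "a = 0") auto
  have le: "r x' \<le> r x" if "0 \<le> x" "x \<le> x'" for x x'
    using anti that by (auto simp: monotone_on_def)
  have lt: "r x < y" if "x > a" for x
  proof (rule ccontr)
    assume "\<not> r x < y"
    with that a have eq: "r x = y"
      using le[of a x] by auto
    have "x < b"
      using le[of b x] b eq by (cases "x < b") auto
    \<comment> \<open>A plateau from a to x would have slope 0, yet slopes from a increase and the
      one towards b is negative.\<close>
    have "(r a - r x) / (a - x) \<le> (r a - r b) / (a - b)"
      using a that \<open>x < b\<close> by (intro convex_on_slope_le[OF conv]) auto
    moreover have "(r a - r b) / (a - b) < 0"
      using b a that \<open>x < b\<close> by (intro divide_pos_neg) auto
    ultimately show False
      using eq a by simp
  qed
  define q where "q d = (y - r (a + d)) / d" for d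
  have q_anti: "q d' \<le> q d" if "0 < d" "d \<le> d'" for d d'
  proof (cases "d = d'")
    case False
    then have "(r a - r (a + d)) / (a - (a + d)) \<le> (r a - r (a + d')) / (a - (a + d'))"
      using a that by (intro convex_on_slope_le[OF conv]) auto
    then show ?thesis
      using a by (simp add: q_def)
  qed simp
  have q_le: "q d \<le> (r 0 - y) / a" if "0 < d" for d
  proof -
    \<comment> \<open>Three-chord comparison on 0 < a < a + d; this is where a being interior to the
      half-line matters.\<close>
    have "(r 0 - r a) / (0 - a) \<le> (r 0 - r (a + d)) / (0 - (a + d))"
      "(r 0 - r (a + d)) / (0 - (a + d)) \<le> (r a - r (a + d)) / (a - (a + d))"
      using \<open>a > 0\<close> that by (intro convex_on_slope_le[OF conv]; auto)+
    then show ?thesis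
      using a by (simp add: q_def)
  qed
  define l where "l = (SUP d\<in>{0<..}. q d)"
  have bdd: "bdd_above (q ` {0<..})"
    using q_le by (auto intro!: bdd_aboveI)
  have q_l: "q d \<le> l" if "d > 0" for d
    unfolding l_def using that by (intro cSUP_upper bdd) auto
  have "0 < q 1"
    using lt[of "a + 1"] by (simp add: q_def)
  also have "\<dots> \<le> l" by (rule q_l) simp
  finally have "l > 0" .
  moreover have "(q \<longlongrightarrow> l) (at_right 0)"
  proof (rule order_tendstoI)
    fix c assume "c < l"
    then obtain d where d: "d > 0" "c < q d"
      unfolding l_def by (subst (asm) less_cSUP_iff) (use bdd in auto)
    then show "\<forall>\<^sub>F x in at_right 0. c < q x"
      by (intro eventually_at_rightI[of 0 d]) (auto intro: less_le_trans[OF _ q_anti])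
  next
    fix c assume "l < c"
    then show "\<forall>\<^sub>F x in at_right 0. q x < c"
      by (intro eventually_at_rightI[of 0 1]) (auto intro: le_less_trans[OF q_l])
  qed
  moreover from this have "((\<lambda>d. (y - r (a + d)) / d) \<longlongrightarrow> l) (at_right 0)"
    by (simp add: q_def[abs_def])
  ultimately show thesis
    using that[of a l] \<open>a > 0\<close> lt le[of _ a] a(3) by auto
qed

section \<open>Functions of the discount rate stable under products, averages and series\<close>

text \<open>The bundle carries what \<open>convex_antimono_crossing\<close> asks for. Sign and
  monotonicity are also what keeps products convex, and the uniform bound B serves dominated
  convergence and the summation of series.\<close>

definition damped :: "real \<Rightarrow> (real \<Rightarrow> real) \<Rightarrow> bool" where
  "damped B f \<longleftrightarrow> (\<forall>\<gamma>\<ge>0. 0 \<le> f \<gamma> \<and> f \<gamma> \<le> B) \<and>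
     antimono_on {0..} f \<and> convex_on {0..} f \<and> continuous_on {0..} f"

lemma dampedD:
  assumes "damped B f"
  shows "\<gamma> \<ge> 0 \<Longrightarrow> 0 \<le> f \<gamma>" "\<gamma> \<ge> 0 \<Longrightarrow> f \<gamma> \<le> B" "antimono_on {0..} f"
    "convex_on {0..} f" "continuous_on {0..} f"
  using assms by (auto simp: damped_def)

lemma damped_exp:
  assumes "c \<ge> 0"
  shows "damped 1 (\<lambda>\<gamma>. exp (- \<gamma> * c))"
  unfolding damped_def
proof (intro conjI)
  show "convex_on {0..} (\<lambda>\<gamma>. exp (- \<gamma> * c))"
  proof (rule f''_ge0_imp_convex)
    show "((\<lambda>\<gamma>. exp (- \<gamma> * c)) has_real_derivative - c * exp (- \<gamma> * c)) (at \<gamma>)"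
      "((\<lambda>\<gamma>. - c * exp (- \<gamma> * c)) has_real_derivative c * c * exp (- \<gamma> * c)) (at \<gamma>)" for \<gamma>
      by (auto intro!: derivative_eq_intros)
  qed auto
  show "antimono_on {0..} (\<lambda>\<gamma>. exp (- \<gamma> * c))"
    using assms by (auto simp: monotone_on_def intro: mult_right_mono)
qed (use assms in \<open>auto intro!: continuous_intros\<close>)

lemma damped_mult:
  assumes f: "damped A f" and g: "damped B g"
  shows "damped (A * B) (\<lambda>\<gamma>. f \<gamma> * g \<gamma>)"
  unfolding damped_def
proof (intro conjI allI impI)
  fix \<gamma> :: real assume "\<gamma> \<ge> 0"
  then show "0 \<le> f \<gamma> * g \<gamma>" "f \<gamma> * g \<gamma> \<le> A * B"
    using dampedD(1,2)[OF f, of \<gamma>] dampedD(1,2)[OF g, of \<gamma>] by (simp_all add: mult_mono)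
next
  show "antimono_on {0..} (\<lambda>\<gamma>. f \<gamma> * g \<gamma>)"
    using dampedD(3)[OF f] dampedD(3)[OF g]
    by (auto simp: monotone_on_def intro!: mult_mono dampedD(1)[OF f] dampedD(1)[OF g])
  show "convex_on {0..} (\<lambda>\<gamma>. f \<gamma> * g \<gamma>)"
    using dampedD[OF f] dampedD[OF g] by (intro convex_on_mul_antimono) auto
qed (intro continuous_intros dampedD(5)[OF f] dampedD(5)[OF g])

lemma damped_cmult:
  assumes f: "damped A f" and c: "c \<ge> 0"
  shows "damped (c * A) (\<lambda>\<gamma>. c * f \<gamma>)"
proof (rule damped_mult[OF _ f])
  show "damped c (\<lambda>_. c)"
    using c by (auto simp: damped_def monotone_on_def convex_on_const)
qed

text \<open>Sign, bound, monotonicity and convexity are inequalities that can be integrated;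
  continuity is dominated convergence with the constant B.\<close>

lemma damped_integral:
  assumes Q: "prob_space Q" and m: "\<And>\<gamma>. F \<gamma> \<in> borel_measurable Q"
    and d: "\<And>x. x \<in> space Q \<Longrightarrow> damped B (\<lambda>\<gamma>. F \<gamma> x)"
  shows "damped B (\<lambda>\<gamma>. \<integral>x. F \<gamma> x \<partial>Q)"
    and "\<gamma> \<ge> 0 \<Longrightarrow> integrable Q (F \<gamma>)"
proof -
  interpret prob_space Q by fact
  have int: "integrable Q (F \<gamma>)" if "\<gamma> \<ge> 0" for \<gamma>
    using dampedD(1,2)[OF d that] by (intro integrable_const_bound[of _ B] m AE_I2) auto
  then show "\<gamma> \<ge> 0 \<Longrightarrow> integrable Q (F \<gamma>)" .
  show "damped B (\<lambda>\<gamma>. \<integral>x. F \<gamma> x \<partial>Q)"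
    unfolding damped_def
  proof (intro conjI allI impI)
    fix \<gamma> :: real assume g: "\<gamma> \<ge> 0"
    show "0 \<le> (\<integral>x. F \<gamma> x \<partial>Q)"
      by (intro Bochner_Integration.integral_nonneg dampedD(1)[OF d g])
    show "(\<integral>x. F \<gamma> x \<partial>Q) \<le> B"
      by (intro integral_le_const int AE_I2 dampedD(2)[OF d g] g)
  next
    show "antimono_on {0..} (\<lambda>\<gamma>. \<integral>x. F \<gamma> x \<partial>Q)"
      using monotone_onD[OF dampedD(3)[OF d]] by (intro monotone_onI integral_mono int) auto
    show "convex_on {0..} (\<lambda>\<gamma>. \<integral>x. F \<gamma> x \<partial>Q)"
    proof (rule convex_onI)
      fix t x y :: real
      assume t: "0 < t" "t < 1" and xy: "x \<in> {0..}" "y \<in> {0..}"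
      then have nn: "0 \<le> (1 - t) *\<^sub>R x + t *\<^sub>R y" by auto
      have "(\<integral>z. F ((1 - t) *\<^sub>R x + t *\<^sub>R y) z \<partial>Q) \<le> (\<integral>z. (1 - t) * F x z + t * F y z \<partial>Q)"
        using t xy int nn
        by (intro integral_mono Bochner_Integration.integrable_add integrable_mult_right convex_onD[OF dampedD(4)[OF d]]) auto
      also have "\<dots> = (1 - t) * (\<integral>z. F x z \<partial>Q) + t * (\<integral>z. F y z \<partial>Q)"
        using xy int by (subst Bochner_Integration.integral_add) auto
      finally show "(\<integral>z. F ((1 - t) *\<^sub>R x + t *\<^sub>R y) z \<partial>Q)
          \<le> (1 - t) * (\<integral>z. F x z \<partial>Q) + t * (\<integral>z. F y z \<partial>Q)" .
    qed simp
    show "continuous_on {0..} (\<lambda>\<gamma>. \<integral>x. F \<gamma> x \<partial>Q)"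
    proof (rule continuous_on_sequentiallyI)
      fix u :: "nat \<Rightarrow> real" and a
      assume u: "\<forall>n. u n \<in> {0..}" "a \<in> {0..}" "u \<longlonglongrightarrow> a"
      show "(\<lambda>n. \<integral>x. F (u n) x \<partial>Q) \<longlonglongrightarrow> (\<integral>x. F a x \<partial>Q)"
      proof (rule integral_dominated_convergence[where w="\<lambda>_. B"])
        show "AE x in Q. (\<lambda>n. F (u n) x) \<longlonglongrightarrow> F a x"
        proof (rule AE_I2)
          fix x assume "x \<in> space Q"
          from continuous_on_tendsto_compose[OF dampedD(5)[OF d[OF this]] u(3,2)] u(1)
          show "(\<lambda>n. F (u n) x) \<longlonglongrightarrow> F a x" by simp
        qed
        show "AE x in Q. norm (F (u n) x) \<le> B" for n
          using u(1) dampedD(1,2)[OF d, of _ "u n"] by (intro AE_I2) auto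
      qed (auto intro!: m)
    qed
  qed
qed

text \<open>The inequalities pass to the series termwise; continuity comes from the Weierstrass
  M-test with majorant \<open>b\<close>.\<close>

lemma damped_suminf:
  assumes d: "\<And>k. damped (b k) (f k)" and b: "summable b"
  shows "damped (suminf b) (\<lambda>\<gamma>. \<Sum>k. f k \<gamma>)"
    and "\<gamma> \<ge> 0 \<Longrightarrow> summable (\<lambda>k. f k \<gamma>)"
proof -
  have bound: "\<bar>f k \<gamma>\<bar> \<le> b k" if "\<gamma> \<ge> 0" for k \<gamma>
    using dampedD(1,2)[OF d] that by auto
  have s: "summable (\<lambda>k. f k \<gamma>)" if "\<gamma> \<ge> 0" for \<gamma>
    using bound[OF that] by (intro summable_comparison_test'[OF b]) auto
  then show "\<gamma> \<ge> 0 \<Longrightarrow> summable (\<lambda>k. f k \<gamma>)" .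
  show "damped (suminf b) (\<lambda>\<gamma>. \<Sum>k. f k \<gamma>)"
    unfolding damped_def
  proof (intro conjI allI impI)
    fix \<gamma> :: real assume g: "\<gamma> \<ge> 0"
    show "0 \<le> (\<Sum>k. f k \<gamma>)" "(\<Sum>k. f k \<gamma>) \<le> suminf b"
      by (intro suminf_nonneg suminf_le s[OF g] b dampedD(1)[OF d g] dampedD(2)[OF d g])+
  next
    show "antimono_on {0..} (\<lambda>\<gamma>. \<Sum>k. f k \<gamma>)"
      using dampedD(3)[OF d] by (auto simp: monotone_on_def intro!: suminf_le s)
    show "convex_on {0..} (\<lambda>\<gamma>. \<Sum>k. f k \<gamma>)"
    proof (rule convex_onI)
      fix t x y :: real
      assume t: "0 < t" "t < 1" and xy: "x \<in> {0..}" "y \<in> {0..}"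
      then have nn: "0 \<le> (1 - t) *\<^sub>R x + t *\<^sub>R y" by auto
      have "(\<Sum>k. f k ((1 - t) *\<^sub>R x + t *\<^sub>R y)) \<le> (\<Sum>k. (1 - t) * f k x + t * f k y)"
        using t xy nn
        by (intro suminf_le convex_onD[OF dampedD(4)[OF d]] s summable_add summable_mult) auto
      also have "\<dots> = (1 - t) * (\<Sum>k. f k x) + t * (\<Sum>k. f k y)"
        using xy by (simp add: suminf_add[symmetric] suminf_mult s summable_mult)
      finally show "(\<Sum>k. f k ((1 - t) *\<^sub>R x + t *\<^sub>R y)) \<le> (1 - t) * (\<Sum>k. f k x) + t * (\<Sum>k. f k y)" .
    qed simp
    have "uniform_limit {0..} (\<lambda>n \<gamma>. \<Sum>k<n. f k \<gamma>) (\<lambda>\<gamma>. \<Sum>k. f k \<gamma>) sequentially"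
      using bound b by (intro Weierstrass_m_test) auto
    moreover have "continuous_on {0..} (\<lambda>\<gamma>. \<Sum>k<n. f k \<gamma>)" for n
      by (intro continuous_on_sum dampedD(5)[OF d])
    ultimately show "continuous_on {0..} (\<lambda>\<gamma>. \<Sum>k. f k \<gamma>)"
      by (intro uniform_limit_theorem[OF always_eventually]) auto
  qed
qed

section \<open>Renewal equation of the Knudsen gas\<close>

locale knudsen_gas =
  fixes \<pi> :: "'a::topological_space measure" and U :: "'a \<Rightarrow> 'a measure"
    and \<alpha> :: real and \<xi> :: "'a \<Rightarrow> real"
  assumes prob_space_pi: "prob_space \<pi>" and sets_pi [measurable_cong]: "sets \<pi> = sets borel"
    and kernel_U: "U \<in> borel \<rightarrow>\<^sub>M prob_algebra borel"
    and alpha: "1 / 2 < \<alpha>" "\<alpha> < 1"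
    and xi_measurable [measurable]: "\<xi> \<in> borel_measurable borel"
    and xi_nonneg: "\<xi> x \<ge> 0"
begin

section \<open>Flights of the chain between two redraws\<close>

lemma subprob_kernel_U [measurable]: "U \<in> borel \<rightarrow>\<^sub>M subprob_algebra borel"
  using kernel_U by (rule measurable_prob_algebraD)

lemma prob_space_U: "prob_space (U x)" and sets_U [measurable_cong, simp]: "sets (U x) = sets borel"
  using measurable_space[OF kernel_U, of x] by (auto simp: space_prob_algebra)

lemma space_U [simp]: "space (U x) = UNIV"
  using sets_eq_imp_space_eq[OF sets_U] by simp

lemma space_pi [simp]: "space \<pi> = UNIV"
  using sets_eq_imp_space_eq[OF sets_pi] by simp

text \<open>For the chain started at x, \<open>flight k \<gamma> x\<close> is the part of the n = k term of the series
  for G(\<gamma>) on which no move was drawn from \<open>\<pi>\<close>, and \<open>mass n \<gamma> x\<close> below is the full n-th term.\<close>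

primrec flight :: "nat \<Rightarrow> real \<Rightarrow> 'a \<Rightarrow> real" where
  "flight 0 \<gamma> x = exp (- \<gamma> * \<xi> x)"
| "flight (Suc k) \<gamma> x = 2 * (1 - \<alpha>) * (exp (- \<gamma> * \<xi> x) * (\<integral>y. flight k \<gamma> y \<partial>U x))"

text \<open>The R of the overview: the resolvent of the discounted kernel 2 (1 - \<alpha>) U applied
  to the discount of a single cell.\<close>

definition resolvent :: "real \<Rightarrow> 'a \<Rightarrow> real" where
  "resolvent \<gamma> x = (\<Sum>k. flight k \<gamma> x)"

lemma flight_measurable [measurable]: "flight k \<gamma> \<in> borel_measurable borel"
  by (induction k) simp_all

text \<open>Each U-move contributes at most the factor 2 (1 - \<alpha>) < 1; this geometric bound,
  uniform in the rate, is what makes the resolvent series converge.\<close>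

lemma damped_flight: "damped ((2 * (1 - \<alpha>)) ^ k) (\<lambda>\<gamma>. flight k \<gamma> x)"
proof (induction k arbitrary: x)
  case 0
  then show ?case using damped_exp[OF xi_nonneg[of x]] by simp
next
  case (Suc k)
  have "damped (1 * (2 * (1 - \<alpha>)) ^ k) (\<lambda>\<gamma>. exp (- \<gamma> * \<xi> x) * (\<integral>y. flight k \<gamma> y \<partial>U x))"
    by (intro damped_mult damped_exp xi_nonneg damped_integral prob_space_U Suc) simp
  from damped_cmult[OF this, of "2 * (1 - \<alpha>)"] show ?case
    using alpha by simp
qed

lemma ratio_sums: "summable (\<lambda>k. (2 * (1 - \<alpha>)) ^ k)" "(\<Sum>k. (2 * (1 - \<alpha>)) ^ k) = 1 / (2 * \<alpha> - 1)"
proof -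
  have "norm (2 * (1 - \<alpha>)) < 1"
    using alpha by (simp add: abs_if)
  from summable_geometric[OF this] suminf_geometric[OF this]
  show "summable (\<lambda>k. (2 * (1 - \<alpha>)) ^ k)" "(\<Sum>k. (2 * (1 - \<alpha>)) ^ k) = 1 / (2 * \<alpha> - 1)"
    by simp_all
qed

lemma damped_resolvent: "damped (1 / (2 * \<alpha> - 1)) (\<lambda>\<gamma>. resolvent \<gamma> x)"
  unfolding resolvent_def ratio_sums(2)[symmetric]
  by (rule damped_suminf(1)[of _ "\<lambda>k \<gamma>. flight k \<gamma> x", OF damped_flight ratio_sums(1)])

lemma summable_flight: "\<gamma> \<ge> 0 \<Longrightarrow> summable (\<lambda>k. flight k \<gamma> x)"
  by (rule damped_suminf(2)[of _ "\<lambda>k \<gamma>. flight k \<gamma> x", OF damped_flight ratio_sums(1)])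

lemma resolvent_measurable [measurable]: "resolvent \<gamma> \<in> borel_measurable borel"
  unfolding resolvent_def by measurable

lemma flight_nonneg: "\<gamma> \<ge> 0 \<Longrightarrow> flight k \<gamma> x \<ge> 0"
  by (rule dampedD(1)[OF damped_flight])

lemma resolvent_ge: "\<gamma> \<ge> 0 \<Longrightarrow> exp (- \<gamma> * \<xi> x) \<le> resolvent \<gamma> x"
  using sum_le_suminf[OF summable_flight, of \<gamma> "{0}" x] flight_nonneg
  by (simp add: resolvent_def)

text \<open>Only the discounts after the first cell are bounded by 1. The one kept, exp(-\<gamma>
  \<xi> x), later forces \<open>return_mass\<close> to vanish at large rates.\<close>

lemma flight_le:
  assumes "\<gamma> \<ge> 0"
  shows "flight k \<gamma> x \<le> (2 * (1 - \<alpha>)) ^ k * exp (- \<gamma> * \<xi> x)"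
proof (cases k)
  case (Suc j)
  have "damped ((2 * (1 - \<alpha>)) ^ j) (\<lambda>\<gamma>. \<integral>y. flight j \<gamma> y \<partial>U x)"
    by (intro damped_integral prob_space_U damped_flight) simp
  from dampedD(2)[OF this assms]
  have "exp (- \<gamma> * \<xi> x) * (\<integral>y. flight j \<gamma> y \<partial>U x) \<le> exp (- \<gamma> * \<xi> x) * (2 * (1 - \<alpha>)) ^ j"
    by (intro mult_left_mono) auto
  then have "2 * (1 - \<alpha>) * (exp (- \<gamma> * \<xi> x) * (\<integral>y. flight j \<gamma> y \<partial>U x))
      \<le> 2 * (1 - \<alpha>) * (exp (- \<gamma> * \<xi> x) * (2 * (1 - \<alpha>)) ^ j)"
    using alpha by (intro mult_left_mono) auto
  then show ?thesis
    by (simp add: Suc mult_ac)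
qed simp

lemma resolvent_le:
  assumes "\<gamma> \<ge> 0"
  shows "resolvent \<gamma> x \<le> exp (- \<gamma> * \<xi> x) / (2 * \<alpha> - 1)"
proof -
  have "resolvent \<gamma> x \<le> (\<Sum>k. (2 * (1 - \<alpha>)) ^ k * exp (- \<gamma> * \<xi> x))"
    unfolding resolvent_def using assms
    by (intro suminf_le flight_le summable_flight summable_mult2 ratio_sums)
  also have "\<dots> = exp (- \<gamma> * \<xi> x) / (2 * \<alpha> - 1)"
    using suminf_mult2[OF ratio_sums(1), of "exp (- \<gamma> * \<xi> x)"] ratio_sums(2) by simp
  finally show ?thesis .
qed

lemma flight_zero: "flight k 0 x = (2 * (1 - \<alpha>)) ^ k"
proof (induction k arbitrary: x)
  case (Suc k)
  interpret prob_space "U x" by (rule prob_space_U)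
  show ?case using Suc prob_space by simp
qed simp

lemma resolvent_zero: "resolvent 0 x = 1 / (2 * \<alpha> - 1)"
  by (simp only: resolvent_def flight_zero ratio_sums)

lemma nn_integral_flight:
  assumes "\<gamma> \<ge> 0"
  shows "ennreal (flight (Suc k) \<gamma> x)
    = ennreal (exp (- \<gamma> * \<xi> x)) * (ennreal (2 * (1 - \<alpha>)) * (\<integral>\<^sup>+y. ennreal (flight k \<gamma> y) \<partial>U x))"
proof -
  have "integrable (U x) (flight k \<gamma>)"
    by (rule damped_integral(2)[OF prob_space_U _ damped_flight]) (use assms in auto)
  then have "(\<integral>\<^sup>+y. ennreal (flight k \<gamma> y) \<partial>U x) = ennreal (\<integral>y. flight k \<gamma> y \<partial>U x)"
    using flight_nonneg[OF assms] by (intro nn_integral_eq_integral) auto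
  moreover have "(\<integral>y. flight k \<gamma> y \<partial>U x) \<ge> 0"
    using flight_nonneg[OF assms] by (intro Bochner_Integration.integral_nonneg) auto
  ultimately show ?thesis
    using alpha by (simp add: ennreal_mult[symmetric] mult_ac)
qed

lemma suminf_flight: "\<gamma> \<ge> 0 \<Longrightarrow> (\<Sum>k. ennreal (flight k \<gamma> x)) = ennreal (resolvent \<gamma> x)"
  unfolding resolvent_def by (intro suminf_ennreal2 flight_nonneg summable_flight)

text \<open>First-move decomposition: the k = 0 flight is split off and the others restart after one
  U-move. Stated in \<open>ennreal\<close>, so that sum and integral exchange freely.\<close>

lemma resolvent_eq:
  assumes "\<gamma> \<ge> 0"
  shows "ennreal (resolvent \<gamma> x) = ennreal (exp (- \<gamma> * \<xi> x))
    * (1 + ennreal (2 * (1 - \<alpha>)) * (\<integral>\<^sup>+y. ennreal (resolvent \<gamma> y) \<partial>U x))"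
proof -
  have "ennreal (resolvent \<gamma> x) = ennreal (flight 0 \<gamma> x) + (\<Sum>k. ennreal (flight (Suc k) \<gamma> x))"
    using suminf_offset[of "\<lambda>k. ennreal (flight k \<gamma> x)" 1] by (simp add: suminf_flight[OF assms, symmetric])
  also have "(\<Sum>k. ennreal (flight (Suc k) \<gamma> x))
      = ennreal (exp (- \<gamma> * \<xi> x)) * (ennreal (2 * (1 - \<alpha>)) * (\<integral>\<^sup>+y. (\<Sum>k. ennreal (flight k \<gamma> y)) \<partial>U x))"
    by (subst nn_integral_suminf) (simp_all only: nn_integral_flight[OF assms] ennreal_suminf_cmult, simp)
  finally show ?thesis
    by (simp only: suminf_flight[OF assms] flight.simps distrib_left mult_1_right)
qed

section \<open>The full series and its renewal equation\<close>

primrec mass :: "nat \<Rightarrow> real \<Rightarrow> 'a \<Rightarrow> ennreal" where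
  "mass 0 \<gamma> x = ennreal (exp (- \<gamma> * \<xi> x))"
| "mass (Suc n) \<gamma> x = ennreal (exp (- \<gamma> * \<xi> x))
     * (ennreal (2 * \<alpha>) * (\<integral>\<^sup>+y. mass n \<gamma> y \<partial>\<pi>) + ennreal (2 * (1 - \<alpha>)) * (\<integral>\<^sup>+y. mass n \<gamma> y \<partial>U x))"

lemma mass_measurable [measurable]: "mass n \<gamma> \<in> borel_measurable borel"
  by (induction n) simp_all

text \<open>A crude bound ignoring discounts; it serves to make the truncated sums finite, so that
  an inequality between them can be solved in the reals.\<close>

lemma mass_le:
  assumes "\<gamma> \<ge> 0"
  shows "mass n \<gamma> x \<le> 2 ^ n"
proof (induction n arbitrary: x)
  case 0
  then show ?case using assms xi_nonneg[of x] by (simp add: ennreal_le_1)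
next
  case (Suc n)
  interpret P: prob_space \<pi> by (rule prob_space_pi)
  interpret Q: prob_space "U x" by (rule prob_space_U)
  have "(\<integral>\<^sup>+y. mass n \<gamma> y \<partial>\<pi>) \<le> (\<integral>\<^sup>+y. 2 ^ n \<partial>\<pi>)" "(\<integral>\<^sup>+y. mass n \<gamma> y \<partial>U x) \<le> (\<integral>\<^sup>+y. 2 ^ n \<partial>U x)"
    by (intro nn_integral_mono Suc)+
  then have "(\<integral>\<^sup>+y. mass n \<gamma> y \<partial>\<pi>) \<le> 2 ^ n" "(\<integral>\<^sup>+y. mass n \<gamma> y \<partial>U x) \<le> 2 ^ n"
    using P.emeasure_space_1 Q.emeasure_space_1 by simp_all
  then have "mass (Suc n) \<gamma> x \<le> 1 * (ennreal (2 * \<alpha>) * 2 ^ n + ennreal (2 * (1 - \<alpha>)) * 2 ^ n)"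
    unfolding mass.simps using assms xi_nonneg[of x]
    by (intro mult_mono add_mono) (auto simp: ennreal_le_1)
  also have "\<dots> = ennreal (2 * \<alpha> + 2 * (1 - \<alpha>)) * 2 ^ n"
    using alpha by (subst ennreal_plus) (auto simp: distrib_right)
  finally show ?case by simp
qed

text \<open>The r of the overview: the mean discounted number of redrawn daughters produced by a
  flight started from \<pi>, two daughters being redrawn with probability \<alpha> each.\<close>

definition return_mass :: "real \<Rightarrow> real" where
  "return_mass \<gamma> = 2 * \<alpha> * (\<integral>x. resolvent \<gamma> x \<partial>\<pi>)"

lemma nn_integral_resolvent:
  assumes "prob_space Q" "sets Q = sets borel" "\<gamma> \<ge> 0"
  shows "(\<integral>\<^sup>+x. ennreal (resolvent \<gamma> x) \<partial>Q) = ennreal (\<integral>x. resolvent \<gamma> x \<partial>Q)"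
proof (rule nn_integral_eq_integral)
  show "integrable Q (resolvent \<gamma>)"
    using assms resolvent_measurable
    by (intro damped_integral(2)[OF assms(1) _ damped_resolvent]) (auto cong: measurable_cong_sets)
qed (use dampedD(1)[OF damped_resolvent assms(3)] in auto)

lemma return_mass_nonneg: "\<gamma> \<ge> 0 \<Longrightarrow> return_mass \<gamma> \<ge> 0"
  unfolding return_mass_def using alpha dampedD(1)[OF damped_resolvent]
  by (intro mult_nonneg_nonneg Bochner_Integration.integral_nonneg) auto

lemma nn_integral_resolvent_pi:
  assumes "\<gamma> \<ge> 0"
  shows "ennreal (2 * \<alpha>) * (\<integral>\<^sup>+x. ennreal (resolvent \<gamma> x) \<partial>\<pi>) = ennreal (return_mass \<gamma>)"
proof -
  have "(\<integral>x. resolvent \<gamma> x \<partial>\<pi>) \<ge> 0"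
    using dampedD(1)[OF damped_resolvent assms] by (intro Bochner_Integration.integral_nonneg) auto
  then show ?thesis
    using alpha unfolding return_mass_def nn_integral_resolvent[OF prob_space_pi sets_pi assms]
    by (subst ennreal_mult) auto
qed

text \<open>The redraw contribution does not depend on x, so it is frozen into a constant while the
  U-moves are resummed by \<open>resolvent_eq\<close>. Truncation at N keeps that constant
  finite.\<close>

lemma sum_mass_le:
  assumes "\<gamma> \<ge> 0"
  shows "(\<Sum>n\<le>N. mass n \<gamma> x)
    \<le> (1 + ennreal (2 * \<alpha>) * (\<integral>\<^sup>+y. (\<Sum>n\<le>N. mass n \<gamma> y) \<partial>\<pi>)) * ennreal (resolvent \<gamma> x)"
proof (induction N arbitrary: x)
  case 0
  have "mass 0 \<gamma> x * 1 \<le> ennreal (resolvent \<gamma> x) * (1 + ennreal (2 * \<alpha>) * (\<integral>\<^sup>+y. mass 0 \<gamma> y \<partial>\<pi>))"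
    using resolvent_ge[OF assms] by (intro mult_mono) (auto intro: ennreal_leI)
  then show ?case by (simp add: mult.commute)
next
  case (Suc N)
  let ?c = "\<lambda>N. 1 + ennreal (2 * \<alpha>) * (\<integral>\<^sup>+y. (\<Sum>n\<le>N. mass n \<gamma> y) \<partial>\<pi>)"
  let ?e = "ennreal (exp (- \<gamma> * \<xi> x))"
  let ?b = "ennreal (2 * (1 - \<alpha>))"
  \<comment> \<open>After its first move, the sum up to \<open>Suc N\<close> starts afresh as a sum
    up to N.\<close>
  have "(\<Sum>n\<le>Suc N. mass n \<gamma> x) = ?e * (?c N + ?b * (\<integral>\<^sup>+y. (\<Sum>n\<le>N. mass n \<gamma> y) \<partial>U x))"
    by (simp add: sum.atMost_Suc_shift nn_integral_sum sum_distrib_left distrib_left sum.distrib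
        add.assoc del: sum.atMost_Suc)
  also have "\<dots> \<le> ?e * (?c N + ?b * (\<integral>\<^sup>+y. ?c N * ennreal (resolvent \<gamma> y) \<partial>U x))"
    by (intro mult_left_mono add_mono nn_integral_mono Suc) auto
  also have "\<dots> = ?c N * (?e * (1 + ?b * (\<integral>\<^sup>+y. ennreal (resolvent \<gamma> y) \<partial>U x)))"
    by (subst nn_integral_cmult) (simp_all add: distrib_left mult_ac)
  also have "\<dots> = ?c N * ennreal (resolvent \<gamma> x)"
    by (simp only: resolvent_eq[OF assms, symmetric])
  also have "\<dots> \<le> ?c (Suc N) * ennreal (resolvent \<gamma> x)"
    by (intro mult_right_mono add_mono mult_left_mono nn_integral_mono) auto
  finally show ?case .
qed

lemma suminf_mass_eq:
  "(\<Sum>n. mass n \<gamma> x) = ennreal (exp (- \<gamma> * \<xi> x))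
     * ((1 + ennreal (2 * \<alpha>) * (\<integral>\<^sup>+y. (\<Sum>n. mass n \<gamma> y) \<partial>\<pi>))
        + ennreal (2 * (1 - \<alpha>)) * (\<integral>\<^sup>+y. (\<Sum>n. mass n \<gamma> y) \<partial>U x))"
proof -
  have "(\<Sum>n. mass n \<gamma> x) = mass 0 \<gamma> x + (\<Sum>n. mass (Suc n) \<gamma> x)"
    using suminf_offset[of "\<lambda>n. mass n \<gamma> x" 1] by simp
  then show ?thesis
    by (simp add: nn_integral_suminf suminf_add[symmetric] distrib_left add.assoc)
qed

text \<open>Unrolling \<open>suminf_mass_eq\<close> K times produces the first K flights, each
  weighted by \<open>c\<close>, plus a nonnegative remainder that is dropped. The argument also
  holds when \<open>c\<close> is infinite.\<close>

lemma suminf_mass_ge: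
  assumes "\<gamma> \<ge> 0"
  defines "c \<equiv> 1 + ennreal (2 * \<alpha>) * (\<integral>\<^sup>+y. (\<Sum>n. mass n \<gamma> y) \<partial>\<pi>)"
  shows "c * ennreal (resolvent \<gamma> x) \<le> (\<Sum>n. mass n \<gamma> x)"
proof -
  let ?b = "ennreal (2 * (1 - \<alpha>))"
  have part: "(\<Sum>k<K. c * ennreal (flight k \<gamma> x)) \<le> (\<Sum>n. mass n \<gamma> x)" for K
  proof (induction K arbitrary: x)
    case (Suc K)
    let ?e = "ennreal (exp (- \<gamma> * \<xi> x))"
    have "(\<Sum>k<Suc K. c * ennreal (flight k \<gamma> x))
        = ?e * c + (\<Sum>k<K. c * ennreal (flight (Suc k) \<gamma> x))"
      by (simp add: sum.lessThan_Suc_shift mult.commute del: sum.lessThan_Suc flight.simps(2))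
    also have "\<dots> = ?e * (c + ?b * (\<integral>\<^sup>+y. (\<Sum>k<K. c * ennreal (flight k \<gamma> y)) \<partial>U x))"
      by (simp add: nn_integral_flight[OF assms(1)] nn_integral_sum nn_integral_cmult sum_distrib_left
          distrib_left mult_ac del: flight.simps(2))
    also have "\<dots> \<le> ?e * (c + ?b * (\<integral>\<^sup>+y. (\<Sum>n. mass n \<gamma> y) \<partial>U x))"
      by (intro mult_left_mono add_mono nn_integral_mono Suc) auto
    also have "\<dots> = (\<Sum>n. mass n \<gamma> x)"
      unfolding c_def by (rule suminf_mass_eq[symmetric])
    finally show ?case .
  qed simp
  have "c * ennreal (resolvent \<gamma> x) = (\<Sum>k. c * ennreal (flight k \<gamma> x))"
    by (simp add: suminf_flight[OF assms(1), symmetric])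
  also have "\<dots> \<le> (\<Sum>n. mass n \<gamma> x)"
    by (intro suminf_le_const part) auto
  finally show ?thesis .
qed

text \<open>The upper and lower bounds give the series as \<open>c\<close> times the resolvent, and
  integrating against \<pi> yields the renewal equation c = 1 + c r. Solving it requires c finite,
  which is obtained from the truncated constants \<open>d N\<close>.\<close>

lemma suminf_mass_subcritical:
  assumes \<gamma>: "\<gamma> \<ge> 0" and r: "return_mass \<gamma> < 1"
  shows "(\<Sum>n. mass n \<gamma> x) = ennreal (resolvent \<gamma> x / (1 - return_mass \<gamma>))"
proof -
  let ?r = "return_mass \<gamma>"
  note r0 = return_mass_nonneg[OF \<gamma>]
  define c where "c = 1 + ennreal (2 * \<alpha>) * (\<integral>\<^sup>+y. (\<Sum>n. mass n \<gamma> y) \<partial>\<pi>)"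
  define d where "d N = 1 + ennreal (2 * \<alpha>) * (\<integral>\<^sup>+y. (\<Sum>n\<le>N. mass n \<gamma> y) \<partial>\<pi>)" for N
  interpret P: prob_space \<pi> by (rule prob_space_pi)
  \<comment> \<open>From d \<le> 1 + r d and d finite follows d \<le> 1 / (1 - r), uniformly in
    N.\<close>
  have d_le: "d N \<le> ennreal (1 / (1 - ?r))" for N
  proof -
    have "(\<integral>\<^sup>+y. (\<Sum>n\<le>N. mass n \<gamma> y) \<partial>\<pi>) \<le> (\<integral>\<^sup>+y. (\<Sum>n\<le>N. 2 ^ n) \<partial>\<pi>)"
      by (intro nn_integral_mono sum_mono mass_le \<gamma>)
    also have "\<dots> < \<infinity>"
      using P.emeasure_space_1 by (simp add: power_less_top_ennreal)
    finally have "d N < \<infinity>"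
      by (simp add: d_def ennreal_mult_less_top)
    then obtain z where z: "d N = ennreal z" "z \<ge> 0" by (cases "d N") auto
    have "d N \<le> 1 + ennreal (2 * \<alpha>) * (\<integral>\<^sup>+y. d N * ennreal (resolvent \<gamma> y) \<partial>\<pi>)"
      by (subst d_def, unfold d_def)
         (intro add_mono mult_left_mono nn_integral_mono sum_mass_le \<gamma> order_refl; simp)
    also have "\<dots> = 1 + d N * ennreal ?r"
      by (subst nn_integral_cmult) (simp_all add: nn_integral_resolvent_pi[OF \<gamma>, symmetric] mult_ac)
    finally have "ennreal z \<le> ennreal (1 + z * ?r)"
      using z r0 by (simp add: ennreal_mult[symmetric] flip: ennreal_1 ennreal_plus)
    then have "z * (1 - ?r) \<le> 1"
      using z r0 by (subst (asm) ennreal_le_iff) (auto simp: algebra_simps)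
    then show ?thesis
      using r z by (auto simp: field_simps intro!: ennreal_leI)
  qed
  have c_d: "c = (SUP N. d N)"
  proof -
    have "(\<lambda>N. \<Sum>n\<le>N. (\<integral>\<^sup>+y. mass n \<gamma> y \<partial>\<pi>)) \<longlonglongrightarrow> (\<Sum>n. \<integral>\<^sup>+y. mass n \<gamma> y \<partial>\<pi>)"
      by (intro summable_LIMSEQ') auto
    then have "d \<longlonglongrightarrow> c"
      unfolding d_def c_def by (intro tendsto_intros ennreal_tendsto_cmult) (auto simp: nn_integral_suminf nn_integral_sum)
    moreover have "incseq d"
      unfolding d_def by (intro incseq_SucI add_mono mult_left_mono nn_integral_mono) auto
    ultimately show ?thesis
      using LIMSEQ_SUP LIMSEQ_unique by blast
  qed
  then have "c \<le> ennreal (1 / (1 - ?r))"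
    using d_le by (auto intro: SUP_least)
  then have "c < \<infinity>"
    using ennreal_less_top le_less_trans by (metis infinity_ennreal_def)
  then obtain z where z: "c = ennreal z" "z \<ge> 0" by (cases c) auto
  have V: "(\<Sum>n. mass n \<gamma> x) = c * ennreal (resolvent \<gamma> x)" for x
  proof (rule antisym)
    show "c * ennreal (resolvent \<gamma> x) \<le> (\<Sum>n. mass n \<gamma> x)"
      unfolding c_def by (rule suminf_mass_ge[OF \<gamma>])
    have "(\<Sum>n<N. mass n \<gamma> x) \<le> c * ennreal (resolvent \<gamma> x)" for N
    proof -
      have "(\<Sum>n<N. mass n \<gamma> x) \<le> (\<Sum>n\<le>N. mass n \<gamma> x)"
        by (intro sum_mono2) auto
      also have "\<dots> \<le> d N * ennreal (resolvent \<gamma> x)"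
        unfolding d_def by (rule sum_mass_le[OF \<gamma>])
      also have "\<dots> \<le> c * ennreal (resolvent \<gamma> x)"
        unfolding c_d by (intro mult_right_mono SUP_upper) auto
      finally show ?thesis .
    qed
    then show "(\<Sum>n. mass n \<gamma> x) \<le> c * ennreal (resolvent \<gamma> x)"
      by (intro suminf_le_const) auto
  qed
  have "c = 1 + ennreal (2 * \<alpha>) * (\<integral>\<^sup>+y. c * ennreal (resolvent \<gamma> y) \<partial>\<pi>)"
    unfolding V[symmetric] by (rule c_def)
  also have "\<dots> = 1 + c * ennreal ?r"
    by (subst nn_integral_cmult) (simp_all add: nn_integral_resolvent_pi[OF \<gamma>, symmetric] mult_ac)
  finally have "ennreal z = ennreal (1 + z * ?r)"
    using z r0 by (simp add: ennreal_mult[symmetric] flip: ennreal_1 ennreal_plus)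
  then have "z = 1 + z * ?r"
    using z r0 by (subst (asm) ennreal_inj) auto
  then have "z = 1 / (1 - ?r)"
    using r by (simp add: field_simps)
  then show ?thesis
    using V[of x] z dampedD(1)[OF damped_resolvent \<gamma>] by (simp add: ennreal_mult[symmetric])
qed

text \<open>With r \<ge> 1 the lower bound gives 1 + c \<le> c, hence c is infinite; positivity of
  the resolvent excludes the product of 0 and infinity. The critical case r = 1 is included.\<close>

lemma suminf_mass_supercritical:
  assumes \<gamma>: "\<gamma> \<ge> 0" and r: "return_mass \<gamma> \<ge> 1"
  shows "(\<Sum>n. mass n \<gamma> x) = \<infinity>"
proof -
  define c where "c = 1 + ennreal (2 * \<alpha>) * (\<integral>\<^sup>+y. (\<Sum>n. mass n \<gamma> y) \<partial>\<pi>)"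
  have "1 + c * 1 \<le> 1 + c * ennreal (return_mass \<gamma>)"
    using r by (intro add_mono mult_left_mono) auto
  also have "\<dots> = 1 + ennreal (2 * \<alpha>) * (\<integral>\<^sup>+y. c * ennreal (resolvent \<gamma> y) \<partial>\<pi>)"
    by (subst nn_integral_cmult) (simp_all add: nn_integral_resolvent_pi[OF \<gamma>, symmetric] mult_ac)
  also have "\<dots> \<le> c"
    by (subst (2) c_def, unfold c_def)
       (intro add_mono mult_left_mono nn_integral_mono suminf_mass_ge \<gamma> order_refl; simp)
  finally have "1 + c \<le> c" by simp
  then have "c = \<infinity>"
    by (cases c) (auto simp flip: ennreal_1 ennreal_plus)
  moreover have "ennreal (resolvent \<gamma> x) > 0"
    using less_le_trans[OF exp_gt_zero resolvent_ge[OF \<gamma>]] by simp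
  ultimately show ?thesis
    using suminf_mass_ge[OF \<gamma>, of x] by (simp add: c_def[symmetric] ennreal_top_mult top_unique split: if_splits)
qed

end

section \<open>The series G along the Markov chain\<close>

lemma sets_knudsen_kernel [measurable_cong, simp]:
  "sets (knudsen_kernel \<alpha> \<pi> U x) = sets borel"
  unfolding knudsen_kernel_def using sets.sigma_sets_eq[of borel] by (simp add: sets_measure_of)

lemma space_knudsen_kernel [simp]: "space (knudsen_kernel \<alpha> \<pi> U x) = UNIV"
  using sets_eq_imp_space_eq[OF sets_knudsen_kernel] by simp

lemma subalgebra_past_algebra:
  assumes "\<And>n. X n \<in> borel_measurable M"
  shows "subalgebra M (past_algebra M X n)"
  unfolding subalgebra_def past_algebra_def
proof
  have "(\<lambda>\<omega>. \<lambda>k\<in>{..n}. X k \<omega>) \<in> M \<rightarrow>\<^sub>M (\<Pi>\<^sub>M k\<in>{..n}. borel)"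
    by (intro measurable_restrict assms)
  then show "sets (vimage_algebra (space M) (\<lambda>\<omega>. \<lambda>k\<in>{..n}. X k \<omega>) (\<Pi>\<^sub>M k\<in>{..n}. borel)) \<subseteq> sets M"
    by (intro sets_image_in_sets) simp_all
qed simp

section \<open>Markov property for weighted integrals\<close>

text \<open>\<open>markov_chain\<close> speaks of indicators only. Under M weighted by F, the law of
  \<open>X (Suc n)\<close> and the mixture of the kernels at \<open>X n\<close> are compared as
  measures; agreement on Borel sets then covers every nonnegative measurable \<phi>. Boundedness of
  F provides the integrability that conditional expectations need.\<close>

lemma markov_chain_nn_integral:
  fixes F :: "'w \<Rightarrow> real"
  assumes chain: "markov_chain M P X" and P[measurable]: "P \<in> borel \<rightarrow>\<^sub>M subprob_algebra borel"
    and F: "F \<in> borel_measurable (past_algebra M X n)" "\<And>\<omega>. 0 \<le> F \<omega>" "\<And>\<omega>. F \<omega> \<le> B"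
    and phi[measurable]: "\<phi> \<in> borel_measurable borel"
  shows "(\<integral>\<^sup>+\<omega>. ennreal (F \<omega>) * \<phi> (X (Suc n) \<omega>) \<partial>M)
    = (\<integral>\<^sup>+\<omega>. ennreal (F \<omega>) * (\<integral>\<^sup>+y. \<phi> y \<partial>P (X n \<omega>)) \<partial>M)"
proof -
  have X[measurable]: "X k \<in> borel_measurable M" for k
    using chain by (auto simp: markov_chain_def)
  interpret prob_space M
    using chain by (auto simp: markov_chain_def)
  interpret finite_measure_subalgebra M "past_algebra M X n"
    by unfold_locales (rule subalgebra_past_algebra[OF X])
  have [measurable]: "F \<in> borel_measurable M"
    by (rule measurable_from_subalg[OF subalg F(1)])
  have [simp]: "sets (P x) = sets borel" and sub: "subprob_space (P x)" for x
    using measurable_space[OF P, of x] by (auto simp: space_subprob_algebra)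
  let ?D = "density M (\<lambda>\<omega>. ennreal (F \<omega>))"
  have "distr ?D borel (X (Suc n)) = ?D \<bind> (\<lambda>\<omega>. P (X n \<omega>))"
  proof (rule measure_eqI)
    show "sets (distr ?D borel (X (Suc n))) = sets (?D \<bind> (\<lambda>\<omega>. P (X n \<omega>)))"
      using not_empty by (subst sets_bind[where N=borel]) auto
    fix A assume "A \<in> sets (distr ?D borel (X (Suc n)))"
    then have A[measurable]: "A \<in> sets borel" by simp
    have int: "integrable M (\<lambda>\<omega>. F \<omega> * indicator A (X (Suc n) \<omega>))"
      using F(2,3) order_trans[OF F(2) F(3)]
      by (intro integrable_const_bound[of _ B] AE_I2) (simp_all add: indicator_def)
    have ce: "AE \<omega> in M. real_cond_exp M (past_algebra M X n) (\<lambda>\<omega>. indicator A (X (Suc n) \<omega>)) \<omega>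
        = measure (P (X n \<omega>)) A"
      using chain A by (auto simp: markov_chain_def)
    have m: "(\<lambda>\<omega>. measure (P (X n \<omega>)) A) \<in> borel_measurable M"
      by measurable
    have em: "emeasure (P x) A = ennreal (measure (P x) A)" for x
      by (rule finite_measure.emeasure_eq_measure[OF subprob_space.axioms(1)[OF sub]])
    have le1: "measure (P x) A \<le> 1" for x
      using subprob_space.subprob_measure_le_1[OF sub] .
    have int': "integrable M (\<lambda>\<omega>. F \<omega> * measure (P (X n \<omega>)) A)"
    proof (rule integrable_const_bound[of _ B])
      have "norm (F \<omega> * measure (P (X n \<omega>)) A) \<le> B" for \<omega>
        using mult_left_le[OF le1 F(2)[of \<omega>], of "X n \<omega>"] F(2,3)[of \<omega>] by simp
      then show "AE \<omega> in M. norm (F \<omega> * measure (P (X n \<omega>)) A) \<le> B" by simp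
    qed (use m in measurable)
    have "emeasure (distr ?D borel (X (Suc n))) A = (\<integral>\<^sup>+\<omega>. ennreal (F \<omega> * indicator A (X (Suc n) \<omega>)) \<partial>M)"
      by (subst emeasure_distr)
         (auto simp: emeasure_density indicator_def intro!: nn_integral_cong)
    also have "\<dots> = ennreal (\<integral>\<omega>. F \<omega> * indicator A (X (Suc n) \<omega>) \<partial>M)"
      using F(2) by (intro nn_integral_eq_integral int) auto
    \<comment> \<open>F is measurable with respect to the past, so the indicator may be replaced by
      its conditional expectation.\<close>
    also have "(\<integral>\<omega>. F \<omega> * indicator A (X (Suc n) \<omega>) \<partial>M)
        = (\<integral>\<omega>. F \<omega> * real_cond_exp M (past_algebra M X n) (\<lambda>\<omega>. indicator A (X (Suc n) \<omega>)) \<omega> \<partial>M)"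
      by (rule real_cond_exp_intg(2)[symmetric]) (use int F in auto)
    also have "\<dots> = (\<integral>\<omega>. F \<omega> * measure (P (X n \<omega>)) A \<partial>M)"
    proof (rule integral_cong_AE)
      show "(\<lambda>\<omega>. F \<omega> * real_cond_exp M (past_algebra M X n) (\<lambda>\<omega>. indicator A (X (Suc n) \<omega>)) \<omega>) \<in> borel_measurable M"
        using borel_measurable_cond_exp2 by measurable
    qed (use ce m in auto)
    also have "ennreal \<dots> = (\<integral>\<^sup>+\<omega>. ennreal (F \<omega> * measure (P (X n \<omega>)) A) \<partial>M)"
      using F(2) by (intro nn_integral_eq_integral[symmetric] int') auto
    also have "\<dots> = (\<integral>\<^sup>+\<omega>. emeasure (P (X n \<omega>)) A \<partial>?D)"
      by (subst nn_integral_density)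
         (simp_all only: em ennreal_mult[OF F(2) measure_nonneg], measurable)
    also have "\<dots> = emeasure (?D \<bind> (\<lambda>\<omega>. P (X n \<omega>))) A"
      using not_empty by (intro emeasure_bind[symmetric, where N=borel]) auto
    finally show "emeasure (distr ?D borel (X (Suc n))) A = emeasure (?D \<bind> (\<lambda>\<omega>. P (X n \<omega>))) A" .
  qed
  then have "(\<integral>\<^sup>+y. \<phi> y \<partial>distr ?D borel (X (Suc n))) = (\<integral>\<^sup>+y. \<phi> y \<partial>(?D \<bind> (\<lambda>\<omega>. P (X n \<omega>))))"
    by simp
  then show ?thesis
    by (subst (asm) nn_integral_bind[where B=borel]) (auto simp: nn_integral_distr nn_integral_density)
qed

section \<open>Integration against the Knudsen kernel\<close>

context knudsen_gas
begin

lemma kernel_P [measurable]: "knudsen_kernel \<alpha> \<pi> U \<in> borel \<rightarrow>\<^sub>M subprob_algebra borel"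
proof (rule measurable_subprob_algebra)
  interpret P: prob_space \<pi> by (rule prob_space_pi)
  fix x
  interpret Q: prob_space "U x" by (rule prob_space_U)
  have "emeasure (knudsen_kernel \<alpha> \<pi> U x) UNIV = ennreal \<alpha> + ennreal (1 - \<alpha>)"
    using P.emeasure_space_1 Q.emeasure_space_1 by (subst emeasure_knudsen_kernel) (auto simp: sets_pi)
  also have "\<dots> = 1"
    using alpha by (simp flip: ennreal_plus)
  finally show "subprob_space (knudsen_kernel \<alpha> \<pi> U x)"
    by (intro prob_space_imp_subprob_space prob_spaceI) simp
next
  fix A :: "'a set" assume [measurable]: "A \<in> sets borel"
  have "(\<lambda>x. ennreal \<alpha> * emeasure \<pi> A + ennreal (1 - \<alpha>) * emeasure (U x) A) \<in> borel_measurable borel"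
    by measurable
  then show "(\<lambda>x. emeasure (knudsen_kernel \<alpha> \<pi> U x) A) \<in> borel_measurable borel"
    by (simp add: emeasure_knudsen_kernel sets_pi)
qed simp

text \<open>The kernel is known through its values on sets, so the formula is lifted from indicators
  by linearity and monotone limits.\<close>

lemma nn_integral_knudsen_kernel:
  assumes "\<phi> \<in> borel_measurable borel"
  shows "(\<integral>\<^sup>+y. \<phi> y \<partial>knudsen_kernel \<alpha> \<pi> U x)
    = ennreal \<alpha> * (\<integral>\<^sup>+y. \<phi> y \<partial>\<pi>) + ennreal (1 - \<alpha>) * (\<integral>\<^sup>+y. \<phi> y \<partial>U x)"
  using assms
proof induction
  case (cong f g)
  then show ?case by simp
next
  case (set A)
  then show ?case by (simp add: emeasure_knudsen_kernel sets_pi)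
next
  case (mult u c)
  then show ?case by (simp add: nn_integral_cmult distrib_left mult_ac)
next
  case (add u v)
  then show ?case by (simp add: nn_integral_add distrib_left add_ac)
next
  case (seq F)
  have [measurable]: "F i \<in> borel_measurable borel" for i by fact
  have mono: "incseq (\<lambda>i. ennreal c * (\<integral>\<^sup>+y. F i y \<partial>Q))" for Q c
    using \<open>incseq F\<close> by (intro incseq_SucI mult_left_mono nn_integral_mono) (auto simp: incseq_Suc_iff le_fun_def)
  have eq: "(\<integral>\<^sup>+y. (SUP i. F i) y \<partial>Q) = (SUP i. \<integral>\<^sup>+y. F i y \<partial>Q)" if "sets Q = sets borel" for Q
    using nn_integral_monotone_convergence_SUP[OF \<open>incseq F\<close>, of Q] that
    by (simp add: SUP_apply[abs_def] measurable_cong_sets[OF that refl])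
  show ?case
    unfolding eq[OF sets_knudsen_kernel] eq[OF sets_pi] eq[OF sets_U]
    by (simp add: seq.IH ennreal_SUP_add[OF mono mono] SUP_mult_left_ennreal[symmetric])
qed

end

section \<open>Closed form of G, its abscissa and its pole\<close>

locale knudsen_chain = knudsen_gas \<pi> U \<alpha> \<xi>
  for \<pi> :: "'a::topological_space measure" and U and \<alpha> :: real and \<xi> +
  fixes M :: "'w measure" and X :: "nat \<Rightarrow> 'w \<Rightarrow> 'a"
  assumes chain: "markov_chain M (knudsen_kernel \<alpha> \<pi> U) X"
    and xi_pos: "AE x in \<pi>. \<xi> x > 0"
begin

lemma X_measurable [measurable]: "X n \<in> borel_measurable M"
  using chain by (auto simp: markov_chain_def)

lemma prob_space_M: "prob_space M"
  using chain by (auto simp: markov_chain_def)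

text \<open>Interpolation between the chain and the recursion: n cells are discounted along the
  chain and the rest is carried by \<open>mass\<close>. The induction absorbs the last chain move
  into \<open>mass\<close> by the Markov property, so the value depends on n + m only; m = 0 gives
  the terms of G.\<close>

lemma step_mass:
  assumes \<gamma>: "\<gamma> \<ge> 0"
  shows "2 ^ n * (\<integral>\<^sup>+\<omega>. ennreal (exp (- \<gamma> * (\<Sum>k<n. \<xi> (X k \<omega>)))) * mass m \<gamma> (X n \<omega>) \<partial>M)
    = (\<integral>\<^sup>+\<omega>. mass (n + m) \<gamma> (X 0 \<omega>) \<partial>M)"
proof (induction n arbitrary: m)
  case (Suc n)
  \<comment> \<open>The sum over \<open>k < Suc n\<close> is rewritten with \<open>k \<le> n\<close>
    to exhibit it as a function of X 0, ..., X n.\<close>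
  let ?F = "\<lambda>\<omega>. exp (- \<gamma> * (\<Sum>k\<le>n. \<xi> (X k \<omega>)))"
  have F: "?F \<in> borel_measurable (past_algebra M X n)"
  proof -
    have "(\<lambda>v. exp (- \<gamma> * (\<Sum>k\<le>n. \<xi> (v k)))) \<in> borel_measurable (\<Pi>\<^sub>M k\<in>{..n}. borel)"
      by measurable
    then have "(\<lambda>\<omega>. exp (- \<gamma> * (\<Sum>k\<le>n. \<xi> ((\<lambda>k\<in>{..n}. X k \<omega>) k)))) \<in> borel_measurable (past_algebra M X n)"
      unfolding past_algebra_def
      by (rule measurable_compose[OF measurable_vimage_algebra1, rotated])
         (auto simp: space_PiM PiE_def extensional_def)
    then show ?thesis by simp
  qed
  have "2 ^ Suc n * (\<integral>\<^sup>+\<omega>. ennreal (?F \<omega>) * mass m \<gamma> (X (Suc n) \<omega>) \<partial>M)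
      = 2 ^ Suc n * (\<integral>\<^sup>+\<omega>. ennreal (?F \<omega>) * (\<integral>\<^sup>+y. mass m \<gamma> y \<partial>knudsen_kernel \<alpha> \<pi> U (X n \<omega>)) \<partial>M)"
    using \<gamma> xi_nonneg
    by (subst markov_chain_nn_integral[OF chain kernel_P F, where B=1]) (auto intro!: mult_nonneg_nonneg sum_nonneg)
  also have "\<dots> = 2 ^ n * (\<integral>\<^sup>+\<omega>. 2 * (ennreal (?F \<omega>) * (\<integral>\<^sup>+y. mass m \<gamma> y \<partial>knudsen_kernel \<alpha> \<pi> U (X n \<omega>))) \<partial>M)"
    by (subst nn_integral_cmult) (simp_all add: mult_ac)
  also have "(\<lambda>\<omega>. 2 * (ennreal (?F \<omega>) * (\<integral>\<^sup>+y. mass m \<gamma> y \<partial>knudsen_kernel \<alpha> \<pi> U (X n \<omega>))))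
      = (\<lambda>\<omega>. ennreal (exp (- \<gamma> * (\<Sum>k<n. \<xi> (X k \<omega>)))) * mass (Suc m) \<gamma> (X n \<omega>))"
  proof
    fix \<omega>
    have F_eq: "ennreal (?F \<omega>) = ennreal (exp (- \<gamma> * (\<Sum>k<n. \<xi> (X k \<omega>)))) * ennreal (exp (- \<gamma> * \<xi> (X n \<omega>)))"
      by (simp add: lessThan_Suc_atMost[symmetric] ennreal_mult[symmetric] mult_exp_exp algebra_simps)
    \<comment> \<open>One of the generation factors 2 is merged with the kernel weights \<alpha> and
      1 - \<alpha>.\<close>
    have two: "ennreal (2 * \<alpha>) = 2 * ennreal \<alpha>" "ennreal (2 * (1 - \<alpha>)) = 2 * ennreal (1 - \<alpha>)"
      using alpha by (subst ennreal_mult; simp)+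
    show "2 * (ennreal (?F \<omega>) * (\<integral>\<^sup>+y. mass m \<gamma> y \<partial>knudsen_kernel \<alpha> \<pi> U (X n \<omega>)))
      = ennreal (exp (- \<gamma> * (\<Sum>k<n. \<xi> (X k \<omega>)))) * mass (Suc m) \<gamma> (X n \<omega>)"
      unfolding mass.simps F_eq nn_integral_knudsen_kernel[OF mass_measurable] two
      by (simp only: distrib_left mult_ac)
  qed
  also have "2 ^ n * (\<integral>\<^sup>+\<omega>. ennreal (exp (- \<gamma> * (\<Sum>k<n. \<xi> (X k \<omega>)))) * mass (Suc m) \<gamma> (X n \<omega>) \<partial>M)
      = (\<integral>\<^sup>+\<omega>. mass (n + Suc m) \<gamma> (X 0 \<omega>) \<partial>M)"
    by (rule Suc)
  finally show ?case by (simp add: lessThan_Suc_atMost del: sum.lessThan_Suc mass.simps)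
qed simp

lemma exp_partial_sum:
  assumes "\<gamma> \<ge> 0"
  shows "2 ^ n * (\<integral>\<^sup>+\<omega>. ennreal (exp (- \<gamma> * partial_sum X \<xi> n \<omega>)) \<partial>M) = (\<integral>\<^sup>+\<omega>. mass n \<gamma> (X 0 \<omega>) \<partial>M)"
proof -
  have "exp (- \<gamma> * partial_sum X \<xi> n \<omega>) = exp (- \<gamma> * (\<Sum>k<n. \<xi> (X k \<omega>))) * exp (- \<gamma> * \<xi> (X n \<omega>))" for \<omega>
    by (simp add: partial_sum_def lessThan_Suc_atMost[symmetric] mult_exp_exp algebra_simps)
  then show ?thesis
    using step_mass[OF assms, of n 0] by (simp add: ennreal_mult)
qed

lemma g_term_two:
  "g_term M X \<xi> (\<lambda>_. 2) n \<gamma> = 2 ^ n * (\<integral>\<^sup>+\<omega>. ennreal (exp (- \<gamma> * partial_sum X \<xi> n \<omega>)) \<partial>M)"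
proof -
  have [measurable]: "partial_sum X \<xi> n \<in> borel_measurable M"
    unfolding partial_sum_def[abs_def] by measurable
  show ?thesis
    unfolding g_term_def by (subst nn_integral_cmult[symmetric]) (auto simp: ennreal_mult ennreal_power[symmetric])
qed

text \<open>The \<mu>(R) of the overview, numerator of the closed form of G.\<close>

definition initial_mass :: "real \<Rightarrow> real" where
  "initial_mass \<gamma> = (\<integral>x. resolvent \<gamma> x \<partial>distr M borel (X 0))"

lemma damped_initial_mass: "damped (1 / (2 * \<alpha> - 1)) initial_mass"
  unfolding initial_mass_def[abs_def]
  by (intro damped_integral prob_space.prob_space_distr prob_space_M damped_resolvent) auto

lemma initial_mass_pos:
  assumes "\<gamma> \<ge> 0"
  shows "initial_mass \<gamma> > 0"
proof -
  interpret Q: prob_space "distr M borel (X 0)"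
    by (intro prob_space.prob_space_distr prob_space_M) auto
  have "resolvent \<gamma> x > 0" for x
    using less_le_trans[OF exp_gt_zero resolvent_ge[OF assms]] .
  moreover have "integrable (distr M borel (X 0)) (resolvent \<gamma>)"
    by (rule damped_integral(2)[OF Q.prob_space_axioms _ damped_resolvent]) (use assms in auto)
  ultimately show ?thesis
    using Q.integral_less_AE_space[of "\<lambda>_. 0" "resolvent \<gamma>"] Q.emeasure_space_1
    by (auto simp: initial_mass_def)
qed

lemma G_series_eq_suminf_mass:
  assumes "\<gamma> \<ge> 0"
  shows "G_series M X \<xi> (\<lambda>_. 2) \<gamma> = (\<integral>\<^sup>+\<omega>. (\<Sum>n. mass n \<gamma> (X 0 \<omega>)) \<partial>M)"
  unfolding G_series_def g_term_two exp_partial_sum[OF assms] by (subst nn_integral_suminf) auto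

lemma G_series_subcritical:
  assumes "\<gamma> \<ge> 0" "return_mass \<gamma> < 1"
  shows "G_series M X \<xi> (\<lambda>_. 2) \<gamma> = ennreal (initial_mass \<gamma> / (1 - return_mass \<gamma>))"
proof -
  have "G_series M X \<xi> (\<lambda>_. 2) \<gamma> = (\<integral>\<^sup>+x. ennreal (resolvent \<gamma> x / (1 - return_mass \<gamma>)) \<partial>distr M borel (X 0))"
    unfolding G_series_eq_suminf_mass[OF assms(1)] suminf_mass_subcritical[OF assms]
    by (subst nn_integral_distr) auto
  also have "\<dots> = (\<integral>\<^sup>+x. ennreal (resolvent \<gamma> x) \<partial>distr M borel (X 0)) / ennreal (1 - return_mass \<gamma>)"
    using assms dampedD(1)[OF damped_resolvent]
    by (subst nn_integral_divide[symmetric]) (auto simp: divide_ennreal)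
  also have "\<dots> = ennreal (initial_mass \<gamma> / (1 - return_mass \<gamma>))"
    using assms initial_mass_pos[of \<gamma>]
    by (subst nn_integral_resolvent)
       (auto simp: initial_mass_def divide_ennreal intro!: prob_space.prob_space_distr prob_space_M)
  finally show ?thesis .
qed

lemma G_series_supercritical:
  assumes "\<gamma> \<ge> 0" "return_mass \<gamma> \<ge> 1"
  shows "G_series M X \<xi> (\<lambda>_. 2) \<gamma> = \<infinity>"
proof -
  interpret prob_space M by (rule prob_space_M)
  show ?thesis
    using G_series_eq_suminf_mass[OF assms(1)] suminf_mass_supercritical[OF assms] emeasure_space_1 by simp
qed

lemma damped_return_mass: "damped (2 * \<alpha> * (1 / (2 * \<alpha> - 1))) return_mass"
  unfolding return_mass_def[abs_def] using alpha
  by (intro damped_cmult damped_integral prob_space_pi damped_resolvent) auto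

lemma return_mass_zero: "return_mass 0 > 1"
proof -
  interpret P: prob_space \<pi> by (rule prob_space_pi)
  show ?thesis
    using alpha P.prob_space by (simp add: return_mass_def resolvent_zero field_simps)
qed

text \<open>Dominated convergence: \<open>resolvent_le\<close> gives the pointwise limit wherever
  \<xi> > 0. Integer rates suffice, since a single rate with r < 1 is enough to locate the
  crossing.\<close>

lemma return_mass_vanishes: "(\<lambda>n. return_mass (real n)) \<longlonglongrightarrow> 0"
proof -
  interpret P: prob_space \<pi> by (rule prob_space_pi)
  have "(\<lambda>n. \<integral>x. resolvent (real n) x \<partial>\<pi>) \<longlonglongrightarrow> (\<integral>x. 0 \<partial>\<pi>)"
  proof (rule integral_dominated_convergence[where w="\<lambda>_. 1 / (2 * \<alpha> - 1)"])
    show "AE x in \<pi>. (\<lambda>n. resolvent (real n) x) \<longlonglongrightarrow> 0"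
      using xi_pos
    proof eventually_elim
      case (elim x)
      have "norm (exp (- \<xi> x)) < 1" using elim by simp
      then have "(\<lambda>n. exp (- \<xi> x) ^ n / (2 * \<alpha> - 1)) \<longlonglongrightarrow> 0 / (2 * \<alpha> - 1)"
        by (intro tendsto_divide LIMSEQ_power_zero tendsto_const) (use alpha in auto)
      moreover have "exp (- \<xi> x) ^ n = exp (- real n * \<xi> x)" for n
        by (simp add: exp_of_nat_mult[symmetric])
      ultimately have lim: "(\<lambda>n. exp (- real n * \<xi> x) / (2 * \<alpha> - 1)) \<longlonglongrightarrow> 0"
        by simp
      show ?case
      proof (rule tendsto_sandwich[OF _ _ tendsto_const lim])
        show "\<forall>\<^sub>F n in sequentially. 0 \<le> resolvent (real n) x"
          by (intro always_eventually allI dampedD(1)[OF damped_resolvent]) simp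
        show "\<forall>\<^sub>F n in sequentially. resolvent (real n) x \<le> exp (- real n * \<xi> x) / (2 * \<alpha> - 1)"
          by (intro always_eventually allI resolvent_le) simp
      qed
    qed
    show "AE x in \<pi>. norm (resolvent (real n) x) \<le> 1 / (2 * \<alpha> - 1)" for n
      using dampedD(1,2)[OF damped_resolvent, of "real n"] by auto
  qed auto
  from tendsto_mult_left[OF this, of "2 * \<alpha>"] show ?thesis
    by (simp add: return_mass_def)
qed

lemma critical_rate:
  obtains \<nu> l where "\<nu> > 0" "l > 0" "\<And>\<gamma>. 0 \<le> \<gamma> \<Longrightarrow> \<gamma> \<le> \<nu> \<Longrightarrow> return_mass \<gamma> \<ge> 1"
    "\<And>\<gamma>. \<gamma> > \<nu> \<Longrightarrow> return_mass \<gamma> < 1"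
    "((\<lambda>d. (1 - return_mass (\<nu> + d)) / d) \<longlongrightarrow> l) (at_right 0)"
proof -
  obtain n where "return_mass (real n) < 1"
    using order_tendstoD(2)[OF return_mass_vanishes, of 1] by (auto simp: eventually_sequentially)
  then show thesis
    using convex_antimono_crossing[OF dampedD(4,3,5)[OF damped_return_mass] return_mass_zero of_nat_0_le_iff]
      that by blast
qed

text \<open>G diverges at \<nu> itself, so the set of convergent rates is the open half-line and the
  infimum is not attained.\<close>

lemma growth_rate_eq:
  assumes "\<nu> > 0" "\<And>\<gamma>. 0 \<le> \<gamma> \<Longrightarrow> \<gamma> \<le> \<nu> \<Longrightarrow> return_mass \<gamma> \<ge> 1" "\<And>\<gamma>. \<gamma> > \<nu> \<Longrightarrow> return_mass \<gamma> < 1"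
  shows "growth_rate M X \<xi> (\<lambda>_. 2) = ereal \<nu>"
proof -
  have "{\<gamma>. \<gamma> > 0 \<and> G_series M X \<xi> (\<lambda>_. 2) \<gamma> < \<infinity>} = {\<nu><..}"
  proof (intro set_eqI iffI)
    fix \<gamma> assume "\<gamma> \<in> {\<gamma>. \<gamma> > 0 \<and> G_series M X \<xi> (\<lambda>_. 2) \<gamma> < \<infinity>}"
    then show "\<gamma> \<in> {\<nu><..}"
      using assms(2)[of \<gamma>] G_series_supercritical[of \<gamma>] by (cases "\<gamma> \<le> \<nu>") auto
  next
    fix \<gamma> assume "\<gamma> \<in> {\<nu><..}"
    then show "\<gamma> \<in> {\<gamma>. \<gamma> > 0 \<and> G_series M X \<xi> (\<lambda>_. 2) \<gamma> < \<infinity>}"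
      using assms(1) assms(3)[of \<gamma>] G_series_subcritical[of \<gamma>] by auto
  qed
  moreover have "Inf (ereal ` {\<nu><..}) = ereal \<nu>"
  proof (rule Inf_eqI)
    fix y assume y: "\<And>i. i \<in> ereal ` {\<nu><..} \<Longrightarrow> y \<le> i"
    show "y \<le> ereal \<nu>"
    proof (rule ereal_le_epsilon2)
      fix e :: real assume "0 < e"
      then show "y \<le> ereal \<nu> + ereal e" using y[of "ereal (\<nu> + e)"] by auto
    qed
  qed auto
  ultimately show ?thesis by (simp add: growth_rate_def)
qed

lemma G_series_limit:
  assumes "\<nu> > 0" "\<And>\<gamma>. \<gamma> > \<nu> \<Longrightarrow> return_mass \<gamma> < 1"
    and l: "l > 0" "((\<lambda>d. (1 - return_mass (\<nu> + d)) / d) \<longlongrightarrow> l) (at_right 0)"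
  shows "((\<lambda>\<gamma>. \<gamma> / (\<gamma> + \<nu>) * (initial_mass (\<nu> + \<gamma>) / (1 - return_mass (\<nu> + \<gamma>))))
    \<longlongrightarrow> initial_mass \<nu> / \<nu> / l) (at_right 0)"
proof -
  have shift: "((\<lambda>d. \<nu> + d) \<longlongrightarrow> \<nu>) (at_right 0)" "((\<lambda>d. d + \<nu>) \<longlongrightarrow> \<nu>) (at_right 0)"
    by (auto intro!: tendsto_eq_intros)
  have "((\<lambda>d. initial_mass (\<nu> + d)) \<longlongrightarrow> initial_mass \<nu>) (at_right 0)"
    using assms(1)
    by (intro continuous_on_tendsto_compose[OF dampedD(5)[OF damped_initial_mass] shift(1)])
       (auto intro!: eventually_at_rightI[of 0 1])
  \<comment> \<open>The factor d is moved under 1 - r, turning the vanishing denominator into the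
    difference quotient with limit l > 0.\<close>
  then have "((\<lambda>d. initial_mass (\<nu> + d) / (d + \<nu>) / ((1 - return_mass (\<nu> + d)) / d))
      \<longlongrightarrow> initial_mass \<nu> / \<nu> / l) (at_right 0)"
    using assms by (intro tendsto_divide shift l) auto
  then show ?thesis
    by (rule Lim_transform_eventually) (auto intro!: eventually_at_rightI[of 0 1] simp: field_simps)
qed

end

section \<open>The mean number of cells alive\<close>

text \<open>With two daughters at every split the tree is deterministic, by
  \<open>cell_exists_two_iff\<close>; the expectation can then be taken label by label.\<close>

definition binary_labels :: "nat \<Rightarrow> nat list set" where
  "binary_labels n = {v. set v \<subseteq> {1, 2} \<and> length v = n}"

lemma finite_binary_labels: "finite (binary_labels n)"
  and card_binary_labels: "card (binary_labels n) = 2 ^ n"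
  unfolding binary_labels_def
  using finite_lists_length_eq[of "{1, 2 :: nat}" n] card_lists_length_eq[of "{1, 2 :: nat}" n]
  by (simp_all add: conj_commute numeral_2_eq_2)

lemma cell_exists_two_iff: "cell_exists Y (\<lambda>_. 2) \<omega> v \<longleftrightarrow> v \<in> binary_labels (length v)"
proof -
  have "1 \<le> k \<and> k \<le> 2 \<longleftrightarrow> k \<in> {1, 2}" for k :: nat by auto
  then show ?thesis
    unfolding cell_exists_def binary_labels_def by (auto simp: subset_iff in_set_conv_nth)
qed

lemma alive_cells_two:
  "alive_cells Y \<xi> (\<lambda>_. 2) t \<omega>
    = (\<Union>n. {v \<in> binary_labels n. t \<in> {birth_time Y \<xi> \<omega> v ..< birth_time Y \<xi> \<omega> v + \<xi> (Y v \<omega>)}})"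
  by (auto simp: alive_cells_def cell_exists_two_iff binary_labels_def)

lemma num_alive_two:
  "num_alive Y \<xi> (\<lambda>_. 2) t \<omega>
    = (\<Sum>n. \<Sum>v\<in>binary_labels n. indicator {birth_time Y \<xi> \<omega> v ..< birth_time Y \<xi> \<omega> v + \<xi> (Y v \<omega>)} t)"
proof -
  let ?I = "\<lambda>v. {birth_time Y \<xi> \<omega> v ..< birth_time Y \<xi> \<omega> v + \<xi> (Y v \<omega>)}"
  have "num_alive Y \<xi> (\<lambda>_. 2) t \<omega> = (\<Sum>n. emeasure (count_space UNIV) {v \<in> binary_labels n. t \<in> ?I v})"
    unfolding num_alive_def alive_cells_two
    by (intro suminf_emeasure[symmetric]) (auto simp: disjoint_family_on_def binary_labels_def)
  also have "(\<lambda>n. emeasure (count_space UNIV) {v \<in> binary_labels n. t \<in> ?I v})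
      = (\<lambda>n. \<Sum>v\<in>binary_labels n. indicator (?I v) t)"
  proof
    fix n
    have "emeasure (count_space UNIV) {v \<in> binary_labels n. t \<in> ?I v} = of_nat (card {v \<in> binary_labels n. t \<in> ?I v})"
      using finite_binary_labels by (intro emeasure_count_space_finite) auto
    also have "\<dots> = (\<Sum>v\<in>{v \<in> binary_labels n. t \<in> ?I v}. 1)"
      by simp
    also have "\<dots> = (\<Sum>v\<in>binary_labels n. if t \<in> ?I v then 1 else 0)"
      by (rule sum.inter_filter[OF finite_binary_labels])
    also have "\<dots> = (\<Sum>v\<in>binary_labels n. indicator (?I v) t)"
      by (intro sum.cong) (auto simp: indicator_def)
    finally show "emeasure (count_space UNIV) {v \<in> binary_labels n. t \<in> ?I v}
        = (\<Sum>v\<in>binary_labels n. indicator (?I v) t)" .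
  qed
  finally show ?thesis .
qed

text \<open>\<open>branching_family\<close> prescribes laws along infinite lines only, so a finite
  label is prolonged by first daughters. Truncated subtraction adds nothing while
  \<open>k \<le> n\<close>.\<close>

lemma line_of_descent_through:
  assumes "v \<in> binary_labels n"
  shows "line_of_descent (\<lambda>k. take k v @ replicate (k - n) 1)"
  unfolding line_of_descent_def
proof (intro conjI allI)
  fix k
  show "\<exists>j\<ge>1. take (Suc k) v @ replicate (Suc k - n) 1 = (take k v @ replicate (k - n) 1) @ [j]"
  proof (cases "k < n")
    case True
    then have "v ! k \<in> {1, 2}"
      using assms nth_mem[of k v] unfolding binary_labels_def by blast
    then show ?thesis
      using True assms by (intro exI[of _ "v ! k"]) (auto simp: binary_labels_def take_Suc_conv_app_nth)
  next
    case False
    then show ?thesis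
      using assms by (intro exI[of _ 1]) (auto simp: binary_labels_def Suc_diff_le replicate_append_same)
  qed
qed simp

lemma nn_integral_exp_interval:
  fixes a b \<gamma> :: real
  assumes "\<gamma> > 0" "a \<le> b"
  shows "(\<integral>\<^sup>+s. ennreal (exp (- \<gamma> * s)) * indicator {a..<b} s \<partial>lborel)
    = ennreal ((exp (- \<gamma> * a) - exp (- \<gamma> * b)) / \<gamma>)"
proof -
  have "(\<integral>\<^sup>+s. ennreal (exp (- \<gamma> * s)) * indicator {a..<b} s \<partial>lborel)
      = (\<integral>\<^sup>+s. ennreal (exp (- \<gamma> * s)) * indicator {a..b} s \<partial>lborel)"
    using AE_lborel_singleton[of b]
    by (intro nn_integral_cong_AE) (auto elim!: eventually_mono simp: indicator_def)
  also have "\<dots> = ennreal (- exp (- \<gamma> * b) / \<gamma> - - exp (- \<gamma> * a) / \<gamma>)"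
    using assms by (intro nn_integral_FTC_Icc) (auto intro!: derivative_eq_intros)
  finally show ?thesis by (simp add: diff_divide_distrib)
qed

section \<open>Mean number of cells for an arbitrary sequence of types\<close>

context
  fixes \<xi> :: "'a::topological_space \<Rightarrow> real" and M :: "'w measure" and X :: "nat \<Rightarrow> 'w \<Rightarrow> 'a"
    and M' :: "'v measure" and Y :: "nat list \<Rightarrow> 'v \<Rightarrow> 'a"
  assumes xi[measurable]: "\<xi> \<in> borel_measurable borel" and xi_nonneg: "\<And>x. \<xi> x \<ge> 0"
    and prob_M: "prob_space M" and X[measurable]: "\<And>n. X n \<in> borel_measurable M"
    and branching: "branching_family M' Y M X"
begin

lemma Y_measurable: "v \<in> binary_labels n \<Longrightarrow> Y (take i v) \<in> borel_measurable M'"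
  using branching set_take_subset[of i v] unfolding branching_family_def binary_labels_def by fastforce

text \<open>Birth and death of a cell depend only on its ancestors and itself, all on one line of
  descent, so the prescribed law of that single line determines the probability.\<close>

lemma alive_prob_label:
  assumes v: "v \<in> binary_labels n"
  shows "(\<integral>\<^sup>+\<omega>. indicator {birth_time Y \<xi> \<omega> v ..< birth_time Y \<xi> \<omega> v + \<xi> (Y v \<omega>)} t \<partial>M')
    = (\<integral>\<^sup>+\<omega>. indicator {\<Sum>i<n. \<xi> (X i \<omega>) ..< \<Sum>i<Suc n. \<xi> (X i \<omega>)} t \<partial>M)"
proof -
  define w where "w = (\<lambda>k. take k v @ replicate (k - n) (1::nat))"
  have w: "w k = take k v" if "k \<le> n" for k
    using that by (simp add: w_def)
  have "line_of_descent w"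
    unfolding w_def using v by (rule line_of_descent_through)
  then have pos: "\<forall>k\<in>set (w i). k \<ge> 1" for i
  proof (induction i)
    case (Suc i)
    moreover obtain k where "k \<ge> 1" "w (Suc i) = w i @ [k]"
      using \<open>line_of_descent w\<close> unfolding line_of_descent_def by blast
    ultimately show ?case by auto
  qed (use \<open>line_of_descent w\<close> in \<open>simp add: line_of_descent_def\<close>)
  have Yw[measurable]: "Y (w i) \<in> borel_measurable M'" for i
    using branching pos unfolding branching_family_def by blast
  have eq: "distr M' (\<Pi>\<^sub>M n\<in>UNIV. borel) (\<lambda>\<omega> n. Y (w n) \<omega>) = distr M (\<Pi>\<^sub>M n\<in>UNIV. borel) (\<lambda>\<omega> n. X n \<omega>)"
    using branching \<open>line_of_descent w\<close> by (auto simp: branching_family_def)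
  define f :: "(nat \<Rightarrow> 'a) \<Rightarrow> ennreal" where
    "f y = indicator {\<Sum>i<n. \<xi> (y i) ..< \<Sum>i<Suc n. \<xi> (y i)} t" for y
  have f[measurable]: "f \<in> borel_measurable (\<Pi>\<^sub>M n\<in>UNIV. borel)"
    unfolding f_def[abs_def] indicator_def atLeastLessThan_iff by measurable
  have mY: "(\<lambda>\<omega> n. Y (w n) \<omega>) \<in> M' \<rightarrow>\<^sub>M (\<Pi>\<^sub>M n\<in>UNIV. borel)"
    by (rule measurable_PiM_single') auto
  have mX: "(\<lambda>\<omega> n. X n \<omega>) \<in> M \<rightarrow>\<^sub>M (\<Pi>\<^sub>M n\<in>UNIV. borel)"
    by (rule measurable_PiM_single') auto
  have "length v = n" using v by (simp add: binary_labels_def)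
  then have "birth_time Y \<xi> \<omega> v = (\<Sum>i<n. \<xi> (Y (w i) \<omega>))"
      "birth_time Y \<xi> \<omega> v + \<xi> (Y v \<omega>) = (\<Sum>i<Suc n. \<xi> (Y (w i) \<omega>))" for \<omega>
    using w[of n] by (auto simp: birth_time_def w)
  then have "(\<integral>\<^sup>+\<omega>. indicator {birth_time Y \<xi> \<omega> v ..< birth_time Y \<xi> \<omega> v + \<xi> (Y v \<omega>)} t \<partial>M')
      = (\<integral>\<^sup>+\<omega>. f (\<lambda>n. Y (w n) \<omega>) \<partial>M')"
    by (simp add: f_def)
  also have "\<dots> = (\<integral>\<^sup>+y. f y \<partial>distr M' (\<Pi>\<^sub>M n\<in>UNIV. borel) (\<lambda>\<omega> n. Y (w n) \<omega>))"
    using f by (intro nn_integral_distr[OF mY, symmetric]) simp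
  also have "\<dots> = (\<integral>\<^sup>+\<omega>. f (\<lambda>n. X n \<omega>) \<partial>M)"
    unfolding eq using f by (intro nn_integral_distr[OF mX]) simp
  finally show ?thesis
    by (simp add: f_def)
qed

text \<open>Linearity of expectation: the 2^n labels of a generation have the same probability of
  being alive, whatever their joint law.\<close>

lemma mean_alive_two:
  "mean_alive M' Y \<xi> (\<lambda>_. 2) t
    = (\<Sum>n. 2 ^ n * (\<integral>\<^sup>+\<omega>. indicator {\<Sum>i<n. \<xi> (X i \<omega>) ..< \<Sum>i<Suc n. \<xi> (X i \<omega>)} t \<partial>M))"
proof -
  have m: "(\<lambda>\<omega>. indicator {birth_time Y \<xi> \<omega> v ..< birth_time Y \<xi> \<omega> v + \<xi> (Y v \<omega>)} t :: ennreal) \<in> borel_measurable M'"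
    if v: "v \<in> binary_labels n" for v n
  proof -
    have [measurable]: "Y (take i v) \<in> borel_measurable M'" for i
      by (rule Y_measurable[OF v])
    have [measurable]: "Y v \<in> borel_measurable M'"
      using Y_measurable[OF v, of "length v"] by simp
    show ?thesis
      unfolding birth_time_def indicator_def atLeastLessThan_iff by measurable
  qed
  have "mean_alive M' Y \<xi> (\<lambda>_. 2) t = (\<Sum>n. \<Sum>v\<in>binary_labels n.
      \<integral>\<^sup>+\<omega>. indicator {birth_time Y \<xi> \<omega> v ..< birth_time Y \<xi> \<omega> v + \<xi> (Y v \<omega>)} t \<partial>M')"
    unfolding mean_alive_def num_alive_two
    using m by (subst nn_integral_suminf) (auto simp: nn_integral_sum)
  then show ?thesis
    by (simp add: alive_prob_label card_binary_labels del: sum.lessThan_Suc cong: sum.cong)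
qed

lemma interval_measurable [measurable]:
  "(\<lambda>(s, \<omega>). indicator {\<Sum>i<n. \<xi> (X i \<omega>) ..< \<Sum>i<Suc n. \<xi> (X i \<omega>)} s :: ennreal) \<in> borel_measurable (borel \<Otimes>\<^sub>M M)"
  unfolding indicator_def atLeastLessThan_iff by measurable

lemma mean_alive_measurable: "mean_alive M' Y \<xi> (\<lambda>_. 2) \<in> borel_measurable borel"
proof -
  interpret prob_space M by (rule prob_M)
  have "(\<lambda>t. \<integral>\<^sup>+\<omega>. indicator {\<Sum>i<n. \<xi> (X i \<omega>) ..< \<Sum>i<Suc n. \<xi> (X i \<omega>)} t \<partial>M) \<in> borel_measurable borel" for n
    by (rule borel_measurable_nn_integral[OF interval_measurable])
  then show ?thesis
    unfolding mean_alive_two[abs_def] by measurable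
qed

text \<open>Summation by parts: a generation-n cell contributes the difference of the discounts at birth
  and at death, and the factor 2 between consecutive generations leaves one copy of the series.\<close>

lemma laplace_mean_alive:
  assumes \<gamma>: "\<gamma> > 0" and G: "G_series M X \<xi> (\<lambda>_. 2) \<gamma> = ennreal g" "g \<ge> 0"
  shows "(\<integral>\<^sup>+s\<in>{0..}. ennreal (exp (- \<gamma> * s)) * mean_alive M' Y \<xi> (\<lambda>_. 2) s \<partial>lborel)
    = ennreal ((1 + g) / \<gamma>)"
proof -
  interpret prob_space M by (rule prob_M)
  interpret pair_sigma_finite lborel M ..
  \<comment> \<open>\<open>S n\<close> sums over i < n: it is the birth time in generation n, while
    \<open>partial_sum X \<xi> n\<close> is the death time \<open>S (Suc n)\<close>.\<close>
  define S where "S n \<omega> = (\<Sum>i<n. \<xi> (X i \<omega>))" for n \<omega>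
  have S[measurable]: "S n \<in> borel_measurable M" for n
    unfolding S_def[abs_def] by measurable
  have S0: "S n \<omega> \<ge> 0" and S_mono: "S n \<omega> \<le> S (Suc n) \<omega>" for n \<omega>
    using xi_nonneg by (auto simp: S_def intro!: sum_nonneg)
  define a where "a n = (\<integral>\<omega>. exp (- \<gamma> * S n \<omega>) \<partial>M)" for n
  have int: "integrable M (\<lambda>\<omega>. exp (- \<gamma> * S n \<omega>))" for n
    using S0 \<gamma> by (intro integrable_const_bound[of _ 1]) auto
  have a_nn: "a n \<ge> 0" for n
    unfolding a_def by (intro Bochner_Integration.integral_nonneg) auto
  have a_diff: "(\<integral>\<omega>. (exp (- \<gamma> * S n \<omega>) - exp (- \<gamma> * S (Suc n) \<omega>)) / \<gamma> \<partial>M) = (a n - a (Suc n)) / \<gamma>" for n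
    using int by (simp add: a_def)
  have diff_nn: "0 \<le> (exp (- \<gamma> * S n \<omega>) - exp (- \<gamma> * S (Suc n) \<omega>)) / \<gamma>" for n \<omega>
    using \<gamma> S_mono by simp
  have a_mono: "(a n - a (Suc n)) / \<gamma> \<ge> 0" for n
    unfolding a_diff[symmetric] using diff_nn by (intro Bochner_Integration.integral_nonneg)
  have gen: "(\<integral>\<^sup>+s. (\<integral>\<^sup>+\<omega>. ennreal (exp (- \<gamma> * s)) * indicator {S n \<omega> ..< S (Suc n) \<omega>} s \<partial>M) \<partial>lborel)
      = ennreal ((a n - a (Suc n)) / \<gamma>)" for n
  proof -
    have "(\<integral>\<^sup>+s. (\<integral>\<^sup>+\<omega>. ennreal (exp (- \<gamma> * s)) * indicator {S n \<omega> ..< S (Suc n) \<omega>} s \<partial>M) \<partial>lborel)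
        = (\<integral>\<^sup>+\<omega>. (\<integral>\<^sup>+s. ennreal (exp (- \<gamma> * s)) * indicator {S n \<omega> ..< S (Suc n) \<omega>} s \<partial>lborel) \<partial>M)"
    proof (rule Fubini'[symmetric])
      show "(\<lambda>(s, \<omega>). ennreal (exp (- \<gamma> * s)) * indicator {S n \<omega> ..< S (Suc n) \<omega>} s) \<in> borel_measurable (lborel \<Otimes>\<^sub>M M)"
        unfolding indicator_def atLeastLessThan_iff by measurable
    qed
    also have "\<dots> = (\<integral>\<^sup>+\<omega>. ennreal ((exp (- \<gamma> * S n \<omega>) - exp (- \<gamma> * S (Suc n) \<omega>)) / \<gamma>) \<partial>M)"
      by (simp only: nn_integral_exp_interval[OF \<gamma> S_mono])
    also have "\<dots> = ennreal ((a n - a (Suc n)) / \<gamma>)"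
      unfolding a_diff[symmetric]
      using int diff_nn by (intro nn_integral_eq_integral) auto
    finally show ?thesis .
  qed
  have "(\<integral>\<^sup>+s\<in>{0..}. ennreal (exp (- \<gamma> * s)) * mean_alive M' Y \<xi> (\<lambda>_. 2) s \<partial>lborel)
      = (\<integral>\<^sup>+s. (\<Sum>n. 2 ^ n * (\<integral>\<^sup>+\<omega>. ennreal (exp (- \<gamma> * s)) * indicator {S n \<omega> ..< S (Suc n) \<omega>} s \<partial>M)) \<partial>lborel)"
  proof (intro nn_integral_cong)
    fix s :: real
    have m: "(\<lambda>\<omega>. indicator {S n \<omega> ..< S (Suc n) \<omega>} s :: ennreal) \<in> borel_measurable M" for n
      unfolding indicator_def atLeastLessThan_iff by measurable
    have "ennreal (exp (- \<gamma> * s)) * mean_alive M' Y \<xi> (\<lambda>_. 2) s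
       = (\<Sum>n. 2 ^ n * (\<integral>\<^sup>+\<omega>. ennreal (exp (- \<gamma> * s)) * indicator {S n \<omega> ..< S (Suc n) \<omega>} s \<partial>M))"
      unfolding mean_alive_two S_def[symmetric] ennreal_suminf_cmult[symmetric] nn_integral_cmult[OF m]
      by (simp only: mult_ac)
    moreover have "mean_alive M' Y \<xi> (\<lambda>_. 2) s = 0" if "s < 0"
    proof -
      have "s \<notin> {S n \<omega> ..< S (Suc n) \<omega>}" for n \<omega>
        using S0[of n \<omega>] that by auto
      then show ?thesis
        unfolding mean_alive_two S_def[symmetric] by simp
    qed
    ultimately show "ennreal (exp (- \<gamma> * s)) * mean_alive M' Y \<xi> (\<lambda>_. 2) s * indicator {0..} s
       = (\<Sum>n. 2 ^ n * (\<integral>\<^sup>+\<omega>. ennreal (exp (- \<gamma> * s)) * indicator {S n \<omega> ..< S (Suc n) \<omega>} s \<partial>M))"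
      by (cases "s < 0") auto
  qed
  also have "\<dots> = (\<Sum>n. 2 ^ n * (\<integral>\<^sup>+s. (\<integral>\<^sup>+\<omega>. ennreal (exp (- \<gamma> * s)) * indicator {S n \<omega> ..< S (Suc n) \<omega>} s \<partial>M) \<partial>lborel))"
  proof -
    have m: "(\<lambda>s. \<integral>\<^sup>+\<omega>. ennreal (exp (- \<gamma> * s)) * indicator {S n \<omega> ..< S (Suc n) \<omega>} s \<partial>M) \<in> borel_measurable lborel" for n
      unfolding indicator_def atLeastLessThan_iff by measurable
    show ?thesis
      unfolding nn_integral_cmult[OF m, symmetric]
      by (rule nn_integral_suminf) (intro borel_measurable_times_ennreal m borel_measurable_const)
  qed
  also have "\<dots> = (\<Sum>n. ennreal (2 ^ n * ((a n - a (Suc n)) / \<gamma>)))"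
  proof -
    have "ennreal (2 ^ n * ((a n - a (Suc n)) / \<gamma>)) = 2 ^ n * ennreal ((a n - a (Suc n)) / \<gamma>)" for n
      by (subst ennreal_mult) (simp_all add: a_mono ennreal_power[symmetric])
    then show ?thesis
      by (simp only: gen)
  qed
  also have "\<dots> = ennreal ((1 + g) / \<gamma>)"
  proof -
    have "(\<Sum>n. ennreal (2 ^ n * a (Suc n))) = ennreal g"
    proof -
      have "g_term M X \<xi> (\<lambda>_. 2) n \<gamma> = ennreal (2 ^ n * a (Suc n))" for n
      proof -
        have "g_term M X \<xi> (\<lambda>_. 2) n \<gamma> = (\<integral>\<^sup>+\<omega>. ennreal (2 ^ n * exp (- \<gamma> * S (Suc n) \<omega>)) \<partial>M)"
          by (simp add: g_term_def partial_sum_def S_def lessThan_Suc_atMost del: sum.lessThan_Suc)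
        also have "\<dots> = ennreal (\<integral>\<omega>. 2 ^ n * exp (- \<gamma> * S (Suc n) \<omega>) \<partial>M)"
          using int by (intro nn_integral_eq_integral) auto
        finally show ?thesis by (simp add: a_def)
      qed
      then show ?thesis
        using G(1) by (simp add: G_series_def)
    qed
    then have b: "(\<lambda>n. 2 ^ n * a (Suc n)) sums g"
      using a_nn G(2) by (intro sums_ennreal[THEN iffD1]) (auto simp: sums_iff)
    have "a 0 = 1"
      using prob_space by (simp add: a_def S_def)
    \<comment> \<open>The term n = 0 contributes 1, and shifting the index in the others releases a
      factor 2, giving 1 + 2 g; subtracting the death terms, whose sum is g, leaves 1 + g.\<close>
    then have "(\<lambda>n. 2 ^ n * a n) sums (2 * g + 1)"
      using sums_Suc[of "\<lambda>n. 2 ^ n * a n" "2 * g"] sums_mult[OF b, of 2] by (simp add: mult.assoc)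
    from sums_divide[OF sums_diff[OF this b], of \<gamma>]
    have "(\<lambda>n. 2 ^ n * ((a n - a (Suc n)) / \<gamma>)) sums ((1 + g) / \<gamma>)"
      by (simp add: algebra_simps diff_divide_distrib)
    then show ?thesis
      using G(2) \<gamma> mult_nonneg_nonneg[OF zero_le_power[of 2] a_mono]
      by (intro sums_unique[symmetric] sums_ennreal[THEN iffD2]) auto
  qed
  finally show ?thesis .
qed

end

section \<open>Growth of the branching process\<close>

theorem theorem2p11:
  fixes \<pi> :: "(real ^ 'd) measure"
    and U :: "real ^ 'd \<Rightarrow> (real ^ 'd) measure"
    and M :: "'w measure" and X :: "nat \<Rightarrow> 'w \<Rightarrow> real ^ 'd"
    and M' :: "'v measure" and Y :: "nat list \<Rightarrow> 'v \<Rightarrow> real ^ 'd"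
    and \<xi> :: "real ^ 'd \<Rightarrow> real" and \<kappa> :: "real ^ 'd \<Rightarrow> nat"
    and h :: "real ^ 'd \<Rightarrow> real" and \<alpha> p :: real
  defines "\<nu> \<equiv> growth_rate M X \<xi> \<kappa>"
  assumes "prob_space \<pi>" and "sets \<pi> = sets borel"
    and "U \<in> borel \<rightarrow>\<^sub>M prob_algebra borel" and "\<pi> \<bind> U = \<pi>"
    and "1 / 2 < \<alpha>" and "\<alpha> < 1"
    and "markov_chain M (knudsen_kernel \<alpha> \<pi> U) X"
    and "p > 1"
    and "\<And>x. h x \<ge> 0" and "distributed M \<pi> (X 0) (\<lambda>x. ennreal (h x))"
    and "integrable \<pi> (\<lambda>x. h x powr p)"
    and "\<xi> \<in> borel_measurable borel" and "\<And>x. \<xi> x \<ge> 0"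
    and "measure \<pi> {x. \<xi> x > 0} = 1"
    and "\<And>x. \<kappa> x = 2"
    and "branching_family M' Y M X"
  shows "\<nu> < \<infinity> \<and>
    (\<forall>\<tau>. 1 < \<tau> \<and> \<tau> < p / (p - 1) \<and> integrable \<pi> (\<lambda>x. \<xi> x powr \<tau>) \<longrightarrow>
      (\<exists>C::real. C > 0 \<and>
        ((\<lambda>\<gamma>. ennreal (\<gamma> / (\<gamma> + real_of_ereal \<nu>))
                * G_series M X \<xi> \<kappa> (real_of_ereal \<nu> + \<gamma>)) \<longlongrightarrow> ennreal C) (at_right 0) \<and>
        ((\<lambda>t. ennreal (1 / t) *
                (\<integral>\<^sup>+s\<in>{0..t}. ennreal (exp (- real_of_ereal \<nu> * s)) * mean_alive M' Y \<xi> \<kappa> s \<partial>lborel))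
          \<longlongrightarrow> ennreal C) at_top))"
proof (intro conjI allI impI)
  have \<kappa>: "\<kappa> = (\<lambda>_. 2)"
    using assms(16) by auto
  note branching = assms(17)
  interpret P: prob_space \<pi> by fact
  interpret knudsen_chain \<pi> U \<alpha> \<xi> M X
  proof
    show "AE x in \<pi>. \<xi> x > 0"
      using P.AE_prob_1[OF assms(15)] by simp
  qed fact+
  obtain \<nu>' l where \<nu>': "\<nu>' > 0" "\<And>\<gamma>. 0 \<le> \<gamma> \<Longrightarrow> \<gamma> \<le> \<nu>' \<Longrightarrow> return_mass \<gamma> \<ge> 1"
      "\<And>\<gamma>. \<gamma> > \<nu>' \<Longrightarrow> return_mass \<gamma> < 1"
    and l: "l > 0" "((\<lambda>d. (1 - return_mass (\<nu>' + d)) / d) \<longlongrightarrow> l) (at_right 0)"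
    by (rule critical_rate) (rule that; simp)
  have \<nu>: "\<nu> = ereal \<nu>'"
    unfolding \<nu>_def \<kappa> by (rule growth_rate_eq[OF \<nu>'])
  then show "\<nu> < \<infinity>" by simp
  fix \<tau> :: real
  \<comment> \<open>The value of the limit found in \<open>G_series_limit\<close>; it is positive
    because all three factors are.\<close>
  define C where "C = initial_mass \<nu>' / \<nu>' / l"
  define g where "g \<gamma> = initial_mass \<gamma> / (1 - return_mass \<gamma>)" for \<gamma>
  have G: "G_series M X \<xi> \<kappa> \<gamma> = ennreal (g \<gamma>)" and g_nonneg: "g \<gamma> \<ge> 0" if "\<gamma> > \<nu>'" for \<gamma>
    using G_series_subcritical[of \<gamma>] initial_mass_pos[of \<gamma>] \<nu>'(1) \<nu>'(3)[of \<gamma>] that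
    by (auto simp: g_def \<kappa>)
  have lim: "((\<lambda>\<gamma>. \<gamma> / (\<gamma> + \<nu>') * g (\<nu>' + \<gamma>)) \<longlongrightarrow> C) (at_right 0)"
    unfolding C_def g_def using \<nu>' l by (intro G_series_limit)
  have C: "C > 0"
    unfolding C_def using initial_mass_pos[of \<nu>'] \<nu>'(1) l(1) by simp
  have "((\<lambda>\<gamma>. ennreal (\<gamma> / (\<gamma> + \<nu>')) * G_series M X \<xi> \<kappa> (\<nu>' + \<gamma>)) \<longlongrightarrow> ennreal C) (at_right 0)"
  proof (rule Lim_transform_eventually[OF tendsto_ennrealI[OF lim]])
    have "ennreal (\<gamma> / (\<gamma> + \<nu>') * g (\<nu>' + \<gamma>)) = ennreal (\<gamma> / (\<gamma> + \<nu>')) * G_series M X \<xi> \<kappa> (\<nu>' + \<gamma>)"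
      if "\<gamma> \<in> {0<..<1}" for \<gamma>
      using that \<nu>'(1) G[of "\<nu>' + \<gamma>"] g_nonneg[of "\<nu>' + \<gamma>"] by (subst ennreal_mult) auto
    then show "\<forall>\<^sub>F \<gamma> in at_right 0. ennreal (\<gamma> / (\<gamma> + \<nu>') * g (\<nu>' + \<gamma>))
        = ennreal (\<gamma> / (\<gamma> + \<nu>')) * G_series M X \<xi> \<kappa> (\<nu>' + \<gamma>)"
      by (intro eventually_at_rightI[of 0 1]) auto
  qed
  moreover have "((\<lambda>t. ennreal (1 / t) * (\<integral>\<^sup>+s\<in>{0..t}.
        ennreal (exp (- \<nu>' * s)) * mean_alive M' Y \<xi> \<kappa> s \<partial>lborel)) \<longlongrightarrow> ennreal C) at_top"
  \<comment> \<open>The tilt by exp(-\<nu>' s) shifts the Laplace variable by \<nu>', so the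
    singularity of G sits at 0 as Karamata's theorem requires.\<close>
  proof (rule karamata_tauberian[where L="\<lambda>\<delta>. (1 + g (\<nu>' + \<delta>)) / (\<nu>' + \<delta>)"])
    have [measurable]: "mean_alive M' Y \<xi> \<kappa> \<in> borel_measurable borel"
      unfolding \<kappa> by (rule mean_alive_measurable[OF xi_measurable xi_nonneg prob_space_M X_measurable branching])
    show "(\<lambda>s. ennreal (exp (- \<nu>' * s)) * mean_alive M' Y \<xi> \<kappa> s) \<in> borel_measurable borel"
      by measurable
    fix \<delta> :: real assume \<delta>: "\<delta> > 0"
    show "(1 + g (\<nu>' + \<delta>)) / (\<nu>' + \<delta>) > 0"
      using g_nonneg[of "\<nu>' + \<delta>"] \<delta> \<nu>'(1) by (intro divide_pos_pos) auto
    have "ennreal (exp (- \<delta> * s)) * (ennreal (exp (- \<nu>' * s)) * m) = ennreal (exp (- (\<nu>' + \<delta>) * s)) * m" for s m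
    proof -
      have "exp (- (\<nu>' + \<delta>) * s) = exp (- \<delta> * s) * exp (- \<nu>' * s)"
        by (simp add: mult_exp_exp algebra_simps)
      then show ?thesis
        by (simp only: ennreal_mult[OF exp_ge_zero exp_ge_zero] mult.assoc)
    qed
    then show "(\<integral>\<^sup>+s\<in>{0..}. ennreal (exp (- \<delta> * s)) * (ennreal (exp (- \<nu>' * s)) * mean_alive M' Y \<xi> \<kappa> s) \<partial>lborel)
        = ennreal ((1 + g (\<nu>' + \<delta>)) / (\<nu>' + \<delta>))"
      using laplace_mean_alive[OF xi_measurable xi_nonneg prob_space_M X_measurable branching, of "\<nu>' + \<delta>" "g (\<nu>' + \<delta>)"]
        G[of "\<nu>' + \<delta>"] g_nonneg[of "\<nu>' + \<delta>"] \<delta> \<nu>'(1) by (simp only: \<kappa>)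
  next
    \<comment> \<open>The 1 in 1 + G contributes \<delta> / (\<nu>' + \<delta>), which vanishes
      since \<nu>' > 0; the Cesaro limit is therefore the same C as for G.\<close>
    have "((\<lambda>\<delta>. \<delta> / (\<nu>' + \<delta>) + \<delta> / (\<delta> + \<nu>') * g (\<nu>' + \<delta>)) \<longlongrightarrow> 0 + C) (at_right 0)"
      using \<nu>'(1) by (intro tendsto_add lim) (auto intro!: tendsto_eq_intros)
    then show "((\<lambda>\<delta>. \<delta> * ((1 + g (\<nu>' + \<delta>)) / (\<nu>' + \<delta>))) \<longlongrightarrow> C) (at_right 0)"
      by (simp add: distrib_left add_divide_distrib add.commute)
  qed (rule C)
  ultimately show "\<exists>C>0.
      ((\<lambda>\<gamma>. ennreal (\<gamma> / (\<gamma> + real_of_ereal \<nu>)) * G_series M X \<xi> \<kappa> (real_of_ereal \<nu> + \<gamma>)) \<longlongrightarrow> ennreal C) (at_right 0) \<and>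
      ((\<lambda>t. ennreal (1 / t) * (\<integral>\<^sup>+s\<in>{0..t}. ennreal (exp (- real_of_ereal \<nu> * s)) * mean_alive M' Y \<xi> \<kappa> s \<partial>lborel))
        \<longlongrightarrow> ennreal C) at_top"
    using C by (auto simp: \<nu>)
qed

end
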